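(* Let $d\geq 2$ be even and $n\geq 1$. (a) If $G$ is a simple connected graph of order $n$, then $\|P_n\|_d\leq\|G\|_d\leq\|K_n\|_d$. (b) If $T$ is a tree of order $n$, then $\|P_n\|_d\leq\|T\|_d\leq\|S_n\|_d$.
   Context: Graphs are finite and simple; "connected" means any two vertices are joined by a walk. For a graph $G$ of order $n$, $A(G)$ is its adjacency matrix ($[A(G)]_{ij}=1$ if $v_i,v_j$ are adjacent, $0$ otherwise), with real eigenvalues $\lambda_1\geq\cdots\geq\lambda_n$. The CHS polynomial of degree $d$ is $h_d(x_1,\dots,x_n)=\sum_{1\leq i_1\leq\cdots\leq i_d\leq n}x_{i_1}\cdots x_{i_d}$, and for even $d\geq2$ the CHS $d$-norm of $G$ is $\|G\|_d=(h_d(\lambda_1,\dots,\lambda_n))^{1/d}$. $P_n$ is the path on $n$ vertices (edges $v_iv_{i+1}$, $1\leq i\leq n-1$), $K_n$ the complete graph on $n$ vertices, and $S_n$ the star with one central vertex joined to $n-1$ leaves (i.e. $K_{n-1,1}$). A tree is a connected graph with no cycles. *)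

theory Defs
  imports
    "Jordan_Normal_Form.Char_Poly"
    "Graph_Theory.Pair_Digraph"
    "Graph_Theory.Digraph_Component"
    "Graph_Theory.Kuratowski"
    "HOL-Combinatorics.Permutations"
begin

text \<open>
  Finite simple graphs are the structures \<open>pair_graph\<close>: finite, symmetric, loop-free and without
  parallel arcs, each edge being represented by its two orientations. The library's
  predicate \<open>forest\<close> cannot be used for them, since it counts the two orientations of an edge
  as a cycle of length 2; a cycle of a simple graph is a library cycle of length at least 3.
\<close>

definition tree_graph :: "'a pair_pre_digraph \<Rightarrow> bool" where
  "tree_graph G \<longleftrightarrow> pair_graph G \<and> Digraph_Component.connected (with_proj G) \<and>
     \<not> (\<exists>p. pre_digraph.cycle (with_proj G) p \<and> length p \<ge> 3)"

definition path_graph :: "nat \<Rightarrow> nat pair_pre_digraph" where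
  "path_graph n = \<lparr> pverts = {1..n},
     parcs = {(i, j). i \<in> {1..n} \<and> j \<in> {1..n} \<and> (j = i + 1 \<or> i = j + 1)} \<rparr>"

definition complete_graph :: "nat \<Rightarrow> nat pair_pre_digraph" where
  "complete_graph n = \<lparr> pverts = {1..n},
     parcs = {(i, j). i \<in> {1..n} \<and> j \<in> {1..n} \<and> i \<noteq> j} \<rparr>"

definition star_graph :: "nat \<Rightarrow> nat pair_pre_digraph" where
  "star_graph n = \<lparr> pverts = {1..n},
     parcs = {(i, j). i \<in> {1..n} \<and> j \<in> {1..n} \<and> i \<noteq> j \<and> (i = 1 \<or> j = 1)} \<rparr>"

lemma pair_graph_path_graph: "pair_graph (path_graph n)"
  by unfold_locales
    (auto simp: path_graph_def symmetric_def sym_def intro: finite_subset[of _ "{1..n} \<times> {1..n}"])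

lemma complete_digraph_complete_graph: "complete_digraph n (with_proj (complete_graph n))"
  by (auto simp: complete_digraph_pair_def complete_graph_def)

lemma complete_bipartite_digraph_star_graph:
  assumes "n \<ge> 1"
  shows "complete_bipartite_digraph (n - 1) 1 (with_proj (star_graph n))"
  unfolding complete_bipartite_digraph_pair_def
proof (intro conjI exI)
  show "finite (pverts (star_graph n))"
    by (simp add: star_graph_def)
  show "pverts (star_graph n) = {2..n} \<union> {1}" "{2..n} \<inter> {1} = {}" "card {2..n} = n - 1"
    "card {1::nat} = 1" "parcs (star_graph n) = {2..n} \<times> {1} \<union> {1} \<times> {2..n}"
    using assms by (auto simp: star_graph_def)
qed

definition adjacency_matrix :: "'a list \<Rightarrow> 'a pair_pre_digraph \<Rightarrow> real mat" where
  "adjacency_matrix vs G =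
     mat (length vs) (length vs) (\<lambda>(i, j). if (vs ! i, vs ! j) \<in> parcs G then 1 else 0)"

lemma det_permute_rows_cols:
  assumes A: "A \<in> carrier_mat n n" and p: "p permutes {0..<n}"
  shows "det (mat n n (\<lambda>(i, j). A $$ (p i, p j))) = det A"
proof -
  define B where "B = mat n n (\<lambda>(i, j). A $$ (p i, j))"
  have B: "B \<in> carrier_mat n n" "transpose_mat B \<in> carrier_mat n n"
    by (auto simp: B_def)
  have p_less: "p i < n" if "i < n" for i
    using permutes_in_image[OF p, of i] that by auto
  have "det (mat n n (\<lambda>(i, j). A $$ (p i, p j))) =
      det (transpose_mat (mat n n (\<lambda>(i, j). transpose_mat B $$ (p i, j))))"
    by (intro arg_cong[where f = det] eq_matI) (auto simp: B_def p_less)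
  also have "\<dots> = det (mat n n (\<lambda>(i, j). transpose_mat B $$ (p i, j)))"
    by (intro det_transpose) auto
  also have "\<dots> = signof p * det B"
    using det_permute_rows[OF B(2) p] det_transpose[OF B(1)] by simp
  also have "\<dots> = signof p * (signof p * det A)"
    using det_permute_rows[OF A p] by (simp add: B_def)
  also have "\<dots> = det A"
    by (simp add: sign_def)
  finally show ?thesis .
qed

lemma char_poly_adjacency_matrix_unique:
  assumes "distinct vs" "distinct ws" "set vs = set ws"
  shows "char_poly (adjacency_matrix vs G) = char_poly (adjacency_matrix ws G)"
proof -
  define n where "n = length ws"
  have "mset vs = mset ws"
    using assms by (simp add: set_eq_iff_mset_eq_distinct)
  then obtain p where p: "p permutes {..<length ws}" and vs: "permute_list p ws = vs"
    by (rule mset_eq_permutation)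
  have p': "p permutes {0..<n}"
    using p by (simp add: n_def atLeast0LessThan)
  have len: "length vs = n"
    using vs by (auto simp: n_def)
  have p_less: "p i < n" if "i < n" for i
    using permutes_in_image[OF p', of i] that by auto
  have nth: "vs ! i = ws ! p i" if "i < n" for i
    using permute_list_nth[OF p, of i] that vs by (simp add: n_def)
  have inj: "p i = p j \<longleftrightarrow> i = j" for i j
    using permutes_inj[OF p'] by (auto simp: inj_def)
  define C where "C = char_poly_matrix (adjacency_matrix ws G)"
  have C: "C \<in> carrier_mat n n"
    by (auto simp: C_def char_poly_matrix_def adjacency_matrix_def n_def)
  have "char_poly_matrix (adjacency_matrix vs G) = mat n n (\<lambda>(i, j). C $$ (p i, p j))"
    by (rule eq_matI)
      (auto simp: C_def char_poly_matrix_def adjacency_matrix_def len n_def[symmetric] nth p_less inj)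
  then show ?thesis
    using det_permute_rows_cols[OF C p'] by (simp add: char_poly_def C_def)
qed

text \<open>
  The eigenvalues of a real matrix with algebraic multiplicity, in non-increasing order.
  For a symmetric matrix all complex eigenvalues are real, so none is lost.
\<close>

definition real_eigenvalues :: "real mat \<Rightarrow> real list" where
  "real_eigenvalues A = rev (sorted_list_of_multiset (proots (char_poly A)))"

text \<open>The choice of the enumeration is immaterial, see \<open>graph_eigenvalues_eq\<close>.\<close>

definition graph_eigenvalues :: "'a pair_pre_digraph \<Rightarrow> real list" where
  "graph_eigenvalues G =
     real_eigenvalues (adjacency_matrix (SOME vs. distinct vs \<and> set vs = pverts G) G)"

lemma graph_eigenvalues_eq:
  assumes "distinct vs" "set vs = pverts G"
  shows "graph_eigenvalues G = real_eigenvalues (adjacency_matrix vs G)"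
proof -
  let ?ws = "SOME vs. distinct vs \<and> set vs = pverts G"
  have "distinct ?ws \<and> set ?ws = pverts G"
    using someI[of "\<lambda>vs. distinct vs \<and> set vs = pverts G" vs] assms by blast
  then show ?thesis
    using char_poly_adjacency_matrix_unique[of ?ws vs G] assms
    by (simp add: graph_eigenvalues_def real_eigenvalues_def)
qed

definition chs :: "nat \<Rightarrow> real list \<Rightarrow> real" where
  "chs d xs = (\<Sum>is | length is = d \<and> sorted is \<and> set is \<subseteq> {..<length xs}. \<Prod>i\<leftarrow>is. xs ! i)"

definition chs_norm :: "nat \<Rightarrow> 'a pair_pre_digraph \<Rightarrow> real" where
  "chs_norm d G = root d (chs d (graph_eigenvalues G))"

end

theory Submission
  imports
    Defs
    "HOL-Computational_Algebra.Polynomial_FPS"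
    "HOL-Computational_Algebra.Fundamental_Theorem_Algebra"
begin

text \<open>
  The generating function of the complete homogeneous symmetric polynomials of the eigenvalues is
  \<open>1 / det (I - X A)\<close>. By Cramer's rule, deleting a vertex divides this series by the generating
  function of the closed walks at that vertex, so its coefficients grow when edges are added. This
  gives the upper bound for connected graphs and reduces the lower bound to spanning trees.

  Cutting a tree rooted at \<open>u\<close> at an edge \<open>uc\<close> leaves two smaller trees, rooted at \<open>u\<close> and \<open>c\<close>. If
  \<open>h\<^sub>1, h\<^sub>2\<close> are their series \<open>1 / det (I - X A)\<close> and \<open>f, g\<close> the generating functions of the
  closed walks at their roots, then the tree itself has the series \<open>h\<^sub>1 h\<^sub>2 / (1 - X\<^sup>2 f g)\<close> and
  \<open>f / (1 - X\<^sup>2 f g)\<close>. Both are coefficientwise monotone in \<open>h\<^sub>1, h\<^sub>2, f, g\<close>, so the comparisons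
  with the path (rooted at an end) and with the star (rooted at its centre) follow by induction.
\<close>

section \<open>Coefficientwise order on formal power series\<close>

definition fps_le :: "real fps \<Rightarrow> real fps \<Rightarrow> bool" (infix "\<preceq>" 50) where
  "f \<preceq> g \<longleftrightarrow> (\<forall>k. fps_nth f k \<le> fps_nth g k)"

lemma fps_le_refl [simp]: "f \<preceq> f"
  by (simp add: fps_le_def)

lemma fps_le_trans [trans]: "f \<preceq> g \<Longrightarrow> g \<preceq> h \<Longrightarrow> f \<preceq> h"
  by (meson fps_le_def order_trans)

lemma fps_le_iff_diff_nonneg: "f \<preceq> g \<longleftrightarrow> 0 \<preceq> g - f"
  by (simp add: fps_le_def)

lemma fps_nonneg_1 [simp]: "0 \<preceq> 1"
  by (simp add: fps_le_def)

lemma fps_nonneg_X_power [simp]: "0 \<preceq> fps_X ^ n"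
  by (simp add: fps_le_def)

lemma fps_nonneg_of_nat [simp]: "0 \<preceq> of_nat n"
  by (simp add: fps_le_def fps_of_nat [symmetric])

lemma fps_nonneg_add: "0 \<preceq> f \<Longrightarrow> 0 \<preceq> g \<Longrightarrow> 0 \<preceq> f + g"
  by (simp add: fps_le_def)

lemma fps_nonneg_mult: "0 \<preceq> f \<Longrightarrow> 0 \<preceq> g \<Longrightarrow> 0 \<preceq> f * g"
  by (simp add: fps_le_def fps_mult_nth sum_nonneg)

lemma fps_mult_mono:
  assumes "f \<preceq> f'" "g \<preceq> g'" "0 \<preceq> f" "0 \<preceq> g"
  shows "f * g \<preceq> f' * g'"
  unfolding fps_le_def fps_mult_nth
proof (intro allI sum_mono mult_mono)
  fix i k :: nat
  show "fps_nth f i \<le> fps_nth f' i" "fps_nth g (k - i) \<le> fps_nth g' (k - i)"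
    "0 \<le> fps_nth g (k - i)"
    using assms by (simp_all add: fps_le_def)
  show "0 \<le> fps_nth f' i"
    using fps_le_trans[OF assms(3,1)] by (simp add: fps_le_def)
qed

text \<open>The inverse \<open>g\<close> satisfies \<open>g = 1 + f * g\<close>. As \<open>f\<close>
  has no constant term, this expresses each coefficient of \<open>g\<close> through earlier ones
  with nonnegative weights.\<close>

lemma fps_geometric_nonneg:
  assumes "0 \<preceq> f" "fps_nth f 0 = 0"
  shows "0 \<preceq> inverse (1 - f)"
proof -
  define g where "g = inverse (1 - f)"
  have "(1 - f) * g = 1"
    unfolding g_def by (rule inverse_mult_eq_1') (use assms in simp)
  then have g: "g = 1 + f * g"
    by (simp add: algebra_simps)
  have "0 \<le> fps_nth g k" for k
  proof (induction k rule: less_induct)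
    case (less k)
    have "0 \<le> fps_nth f i * fps_nth g (k - i)" if "i \<le> k" for i
      using assms less[of "k - i"] that by (cases "i = 0") (auto simp: fps_le_def)
    then have "0 \<le> fps_nth (1 + f * g) k"
      by (auto simp: fps_mult_nth intro!: sum_nonneg add_nonneg_nonneg)
    then show ?case
      using g by simp
  qed
  then show ?thesis
    by (simp add: fps_le_def g_def)
qed

text \<open>The difference of the reciprocals is the quotient of \<open>f - g\<close> by
  \<open>f * g\<close>. Only this quotient has to be nonnegative, not \<open>f - g\<close>
  itself.\<close>

lemma fps_inverse_le_inverse:
  assumes "fps_nth f 0 = 1" "fps_nth g 0 = 1" "0 \<preceq> (f - g) * (inverse f * inverse g)"
  shows "inverse f \<preceq> inverse g"
proof -
  have "inverse g - inverse f = (f * inverse f) * inverse g - (g * inverse g) * inverse f"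
    using assms(1,2) by (simp add: inverse_mult_eq_1')
  also have "\<dots> = (f - g) * (inverse f * inverse g)"
    by (simp add: algebra_simps)
  finally show ?thesis
    using assms(3) by (simp add: fps_le_iff_diff_nonneg[of "inverse f"])
qed

lemma fps_geometric_mono:
  assumes "0 \<preceq> f" "f \<preceq> g" "fps_nth g 0 = 0"
  shows "inverse (1 - f) \<preceq> inverse (1 - g)"
proof (rule fps_inverse_le_inverse)
  have f0: "fps_nth f 0 = 0"
    using assms unfolding fps_le_def by (metis fps_zero_nth order_antisym)
  then show "fps_nth (1 - f) 0 = 1" "fps_nth (1 - g) 0 = 1"
    using assms by simp_all
  have "0 \<preceq> g"
    using assms fps_le_trans by blast
  then show "0 \<preceq> (1 - f - (1 - g)) * (inverse (1 - f) * inverse (1 - g))"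
    using assms f0 by (intro fps_nonneg_mult fps_geometric_nonneg) (simp_all add: fps_le_def)
qed

section \<open>Complete homogeneous symmetric polynomials of eigenvalues\<close>

lemma chs_0: "chs 0 xs = 1"
proof -
  have "{is. length is = 0 \<and> sorted is \<and> set is \<subseteq> {..<length xs}} = {[]}"
    by auto
  then show ?thesis
    by (simp add: chs_def)
qed

lemma chs_Suc_Nil: "chs (Suc d) [] = 0"
proof -
  have "{is. length is = Suc d \<and> sorted is \<and> set is \<subseteq> {..<length ([] :: real list)}} = {}"
    by auto
  then show ?thesis
    unfolding chs_def by (metis sum.empty)
qed

text \<open>A nondecreasing index list either begins with 0, which can be removed, or, being sorted,
  avoids 0 altogether and is the shift of an index list for \<open>xs\<close>.\<close>

lemma chs_Suc_Cons: "chs (Suc d) (x # xs) = x * chs d (x # xs) + chs (Suc d) xs"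
proof -
  define S where "S d n = {is :: nat list. length is = d \<and> sorted is \<and> set is \<subseteq> {..<n}}" for d n
  have fin: "finite (S d n)" for d n
    by (rule finite_subset[OF _ finite_lists_length_eq[of "{..<n}" d]]) (auto simp: S_def)
  have split: "S (Suc d) (Suc n) = (#) 0 ` S d (Suc n) \<union> map Suc ` S (Suc d) n" for n
  proof (intro equalityI subsetI)
    fix l assume l: "l \<in> S (Suc d) (Suc n)"
    then obtain i js where js: "l = i # js"
      by (auto simp: S_def length_Suc_conv)
    show "l \<in> (#) 0 ` S d (Suc n) \<union> map Suc ` S (Suc d) n"
    proof (cases "i = 0")
      case True
      with l js show ?thesis
        by (auto simp: S_def)
    next
      case False
      with l js have pos: "\<forall>j \<in> set l. 0 < j"
        by (auto simp: S_def)
      have "l = map Suc (map (\<lambda>j. j - 1) l)"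
        using pos by (simp add: map_idI o_def)
      moreover have "map (\<lambda>j. j - 1) l \<in> S (Suc d) n"
      proof -
        have "sorted (map (\<lambda>j. j - 1) l)"
          using l unfolding S_def sorted_map by (auto intro: sorted_wrt_mono_rel[rotated])
        moreover have "j - 1 < n" if "j \<in> set l" for j
        proof -
          have "j < Suc n" "0 < j"
            using l that pos by (auto simp: S_def)
          then show ?thesis by simp
        qed
        ultimately show ?thesis
          using l by (auto simp: S_def)
      qed
      ultimately show ?thesis
        by blast
    qed
  next
    fix l assume "l \<in> (#) 0 ` S d (Suc n) \<union> map Suc ` S (Suc d) n"
    then show "l \<in> S (Suc d) (Suc n)"
      by (auto simp: S_def sorted_map sorted_wrt_map)
  qed
  let ?f = "\<lambda>is. \<Prod>i\<leftarrow>is. (x # xs) ! i"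
  have "chs (Suc d) (x # xs) = sum ?f ((#) 0 ` S d (Suc (length xs))) + sum ?f (map Suc ` S (Suc d) (length xs))"
    unfolding chs_def S_def[symmetric] length_Cons split
    by (rule sum.union_disjoint) (auto simp: fin)
  also have "sum ?f ((#) 0 ` S d (Suc (length xs))) = x * chs d (x # xs)"
    by (subst sum.reindex) (simp_all add: chs_def S_def sum_distrib_left)
  also have "sum ?f (map Suc ` S (Suc d) (length xs)) = chs (Suc d) xs"
    by (subst sum.reindex) (auto simp: chs_def S_def o_def inj_on_def)
  finally show ?thesis .
qed

text \<open>By \<open>chs_Suc_Cons\<close>, multiplying the series of \<open>x # xs\<close> by
  \<open>1 - fps_const x * fps_X\<close> gives the series of \<open>xs\<close>.\<close>

lemma chs_generating_function:
  "Abs_fps (\<lambda>d. chs d xs) = inverse (\<Prod>x\<leftarrow>xs. 1 - fps_const x * fps_X)"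
proof (induction xs)
  case Nil
  have "Abs_fps (\<lambda>d. chs d []) = 1"
  proof (rule fps_ext)
    fix d show "fps_nth (Abs_fps (\<lambda>d. chs d [])) d = fps_nth 1 d"
      by (cases d) (simp_all add: chs_0 chs_Suc_Nil)
  qed
  then show ?case by simp
next
  case (Cons x xs)
  let ?g = "\<lambda>xs. Abs_fps (\<lambda>d. chs d xs)"
  have "(1 - fps_const x * fps_X) * ?g (x # xs) = ?g xs"
  proof (rule fps_ext)
    fix d show "fps_nth ((1 - fps_const x * fps_X) * ?g (x # xs)) d = fps_nth (?g xs) d"
      by (cases d) (simp_all add: chs_0 chs_Suc_Cons left_diff_distrib mult.assoc)
  qed
  then have "inverse (1 - fps_const x * fps_X) * ((1 - fps_const x * fps_X) * ?g (x # xs)) =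
      inverse (1 - fps_const x * fps_X) * inverse (\<Prod>x\<leftarrow>xs. 1 - fps_const x * fps_X)"
    using Cons.IH by simp
  also have "inverse (1 - fps_const x * fps_X) * ((1 - fps_const x * fps_X) * ?g (x # xs)) = ?g (x # xs)"
    by (simp add: mult.assoc[symmetric] inverse_mult_eq_1)
  finally show ?case
    by (simp add: fps_inverse_mult)
qed

section \<open>The spectrum of a real symmetric matrix\<close>

lemma symmetric_real_mat_eigenvalue_real:
  fixes A :: "real mat"
  assumes A: "A \<in> carrier_mat n n" and sym: "\<And>i j. i < n \<Longrightarrow> j < n \<Longrightarrow> A $$ (i, j) = A $$ (j, i)"
    and ev: "eigenvalue (map_mat complex_of_real A) z"
  shows "z \<in> \<real>"
proof -
  obtain v where v: "v \<in> carrier_vec n" "v \<noteq> 0\<^sub>v n" "map_mat complex_of_real A *\<^sub>v v = z \<cdot>\<^sub>v v"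
    using ev A by (auto simp: eigenvalue_def eigenvector_def)
  have row: "(\<Sum>j<n. of_real (A $$ (i, j)) * v $ j) = z * v $ i" if "i < n" for i
  proof -
    have "(map_mat complex_of_real A *\<^sub>v v) $ i = (\<Sum>j<n. of_real (A $$ (i, j)) * v $ j)"
      using A v(1) that by (simp add: scalar_prod_def atLeast0LessThan)
    then show ?thesis
      using v(1,3) that by simp
  qed
  \<comment> \<open>\<open>N\<close> is the squared norm of the eigenvector and \<open>S\<close> the
    Hermitian form of \<open>A\<close> at it. Symmetry makes \<open>S\<close> real, so
    \<open>S = z * N\<close> with \<open>N\<close> real and nonzero forces \<open>z\<close> to be
    real.\<close>
  define N where "N = (\<Sum>i<n. v $ i * cnj (v $ i))"
  define S where "S = (\<Sum>i<n. \<Sum>j<n. of_real (A $$ (i, j)) * v $ j * cnj (v $ i))"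
  have "S = (\<Sum>i<n. (\<Sum>j<n. of_real (A $$ (i, j)) * v $ j) * cnj (v $ i))"
    by (simp add: S_def sum_distrib_right)
  also have "\<dots> = z * N"
    by (simp add: row N_def sum_distrib_left mult.assoc)
  finally have S: "S = z * N" .
  have "cnj S = (\<Sum>i<n. \<Sum>j<n. of_real (A $$ (i, j)) * cnj (v $ j) * v $ i)"
    by (simp add: S_def)
  also have "\<dots> = (\<Sum>j<n. \<Sum>i<n. of_real (A $$ (i, j)) * cnj (v $ j) * v $ i)"
    by (rule sum.swap)
  also have "\<dots> = S"
    unfolding S_def by (intro sum.cong refl) (simp add: sym mult_ac)
  finally have cnjS: "cnj S = S" .
  have N: "N = of_real (\<Sum>i<n. (cmod (v $ i))\<^sup>2)"
    by (simp add: N_def complex_norm_square[symmetric] del: of_real_power)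
  obtain i where "i < n" "v $ i \<noteq> 0"
    using v(1,2) by (metis carrier_vecD eq_vecI index_zero_vec(1) index_zero_vec(2))
  then have "(\<Sum>i<n. (cmod (v $ i))\<^sup>2) \<noteq> 0"
    by (subst sum_nonneg_eq_0_iff) auto
  then have "N \<noteq> 0" "cnj N = N"
    unfolding N by (simp_all del: of_real_sum)
  then have "cnj z = z"
    using cnjS S by simp
  then show ?thesis
    using Reals_cnj_iff by blast
qed

text \<open>Induction on the degree: the fundamental theorem of algebra supplies a complex root,
  which is real by hypothesis, and its linear factor is split off.\<close>

lemma real_poly_split_if_complex_roots_real:
  fixes p :: "real poly"
  assumes "lead_coeff p = 1" "\<And>z. poly (map_poly complex_of_real p) z = 0 \<Longrightarrow> z \<in> \<real>"
  shows "p = (\<Prod>x\<in>#proots p. [:-x, 1:])"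
  using assms
proof (induction "degree p" arbitrary: p)
  case 0
  then obtain c where "p = [:c:]"
    by (metis degree_eq_zeroE)
  then show ?case
    using 0 by (simp add: one_pCons)
next
  case (Suc m)
  have "degree (map_poly complex_of_real p) \<noteq> 0"
    using Suc.hyps by simp
  then obtain z where z: "poly (map_poly complex_of_real p) z = 0"
    by (metis fundamental_theorem_of_algebra constant_degree)
  with Suc.prems obtain r where r: "z = of_real r"
    by (auto elim: Reals_cases)
  have "poly p r = 0"
    using z unfolding r by simp
  then obtain q where q: "p = [:-r, 1:] * q"
    by (auto simp: poly_eq_0_iff_dvd elim: dvdE)
  with Suc.prems have q0: "q \<noteq> 0" by auto
  have lead: "lead_coeff q = 1"
    using Suc.prems(1) unfolding q by (subst (asm) lead_coeff_mult) simp
  have "degree p = Suc (degree q)"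
    unfolding q using q0 by (subst degree_mult_eq) auto
  then have m: "m = degree q"
    using Suc.hyps by simp
  interpret map_poly_hom: map_poly_comm_ring_hom complex_of_real ..
  have "w \<in> \<real>" if "poly (map_poly complex_of_real q) w = 0" for w
    by (rule Suc.prems) (simp only: q map_poly_hom.hom_mult poly_mult that mult_zero_right)
  with m have IH: "q = (\<Prod>x\<in>#proots q. [:-x, 1:])"
    using Suc.hyps(1) lead by blast
  have "proots p = {#r#} + proots q"
    unfolding q using q0 by (subst proots_mult) auto
  then have "(\<Prod>x\<in>#proots p. [:-x, 1:]) = [:-r, 1:] * (\<Prod>x\<in>#proots q. [:-x, 1:])"
    by simp
  then show ?case
    using IH q by metis
qed

lemma real_eigenvalues_symmetric:
  assumes A: "A \<in> carrier_mat n n" and sym: "\<And>i j. i < n \<Longrightarrow> j < n \<Longrightarrow> A $$ (i, j) = A $$ (j, i)"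
  shows "char_poly A = (\<Prod>x\<leftarrow>real_eigenvalues A. [:-x, 1:])" "length (real_eigenvalues A) = n"
proof -
  have deg: "degree (char_poly A) = n" "lead_coeff (char_poly A) = 1"
    using degree_monic_char_poly[OF A] by auto
  have "char_poly A = (\<Prod>x\<in>#proots (char_poly A). [:-x, 1:])"
  proof (rule real_poly_split_if_complex_roots_real[OF deg(2)])
    fix z assume "poly (map_poly complex_of_real (char_poly A)) z = 0"
    then have "poly (char_poly (map_mat complex_of_real A)) z = 0"
      using of_real_hom.char_poly_hom[OF A] by metis
    then have "eigenvalue (map_mat complex_of_real A) z"
      using A by (subst eigenvalue_root_char_poly) auto
    then show "z \<in> \<real>"
      using symmetric_real_mat_eigenvalue_real[OF A sym] by blast
  qed
  moreover have ms: "mset (real_eigenvalues A) = proots (char_poly A)"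
    by (simp add: real_eigenvalues_def)
  ultimately show *: "char_poly A = (\<Prod>x\<leftarrow>real_eigenvalues A. [:-x, 1:])"
    by (metis mset_map prod_mset_prod_list)
  show "length (real_eigenvalues A) = n"
    using * deg(1) degree_linear_factors[of uminus "real_eigenvalues A"] by simp
qed

text \<open>The characteristic polynomial read backwards: for real \<open>t \<noteq> 0\<close>, the
  determinant of I - t A is \<open>t ^ n\<close> times the characteristic polynomial at
  \<open>1 / t\<close>.\<close>

lemma det_one_minus_X_symmetric:
  assumes A: "A \<in> carrier_mat n n" and sym: "\<And>i j. i < n \<Longrightarrow> j < n \<Longrightarrow> A $$ (i, j) = A $$ (j, i)"
  shows "det (mat n n (\<lambda>(i, j). (if i = j then 1 else 0) - fps_const (A $$ (i, j)) * fps_X)) =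
    (\<Prod>x\<leftarrow>real_eigenvalues A. 1 - fps_const x * fps_X)"
proof -
  \<comment> \<open>\<open>Q\<close> is I - X A over polynomials instead of series, so that it can
    be evaluated at real numbers.\<close>
  define Q where "Q = mat n n (\<lambda>(i, j). [:if i = j then 1 else 0, - (A $$ (i, j)):])"
  define r where "r = (\<Prod>x\<leftarrow>real_eigenvalues A. [:1, -x:])"
  have Q: "Q \<in> carrier_mat n n"
    by (simp add: Q_def)
  have eq: "poly (det Q) t = poly r t" if "t \<noteq> 0" for t
  proof -
    define B where "B = mat n n (\<lambda>(i, j). (if i = j then 1 / t else 0) - A $$ (i, j))"
    have B: "B \<in> carrier_mat n n"
      by (simp add: B_def)
    have "poly (det Q) t = det (t \<cdot>\<^sub>m B)"
      using that by (intro poly_det_cong[of _ n]) (auto simp: Q_def B_def algebra_simps)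
    also have "\<dots> = t ^ n * det B"
      using B by (simp add: det_smult)
    also have "det B = poly (char_poly A) (1 / t)"
      unfolding char_poly_def using A
      by (intro poly_det_cong[symmetric, of _ n]) (auto simp: char_poly_matrix_def B_def)
    also have "\<dots> = (\<Prod>x\<leftarrow>real_eigenvalues A. 1 / t - x)"
      by (simp add: real_eigenvalues_symmetric(1)[OF A sym] poly_prod_list o_def)
    also have "t ^ n * \<dots> = (\<Prod>x\<leftarrow>real_eigenvalues A. t * (1 / t - x))"
    proof -
      have "t ^ length xs * (\<Prod>x\<leftarrow>xs. 1 / t - x) = (\<Prod>x\<leftarrow>xs. t * (1 / t - x))" for xs
        by (induction xs) (simp_all add: mult_ac)
      then show ?thesis
        using real_eigenvalues_symmetric(2)[OF A sym] by metis
    qed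
    also have "\<dots> = poly r t"
      using that by (simp add: r_def poly_prod_list o_def algebra_simps)
    finally show ?thesis .
  qed
  \<comment> \<open>The pointwise identity excludes 0. The extra factor X makes it hold there as
    well and is cancelled afterwards.\<close>
  have "poly ([:0, 1:] * det Q) = poly ([:0, 1:] * r)"
    using eq by (intro ext) (auto simp del: mult_pCons_left simp: poly_mult)
  then have "det Q = r"
    by (metis mult_left_cancel pCons_eq_0_iff poly_eq_poly_eq_iff zero_neq_one)
  interpret fps: comm_ring_hom "fps_of_poly :: real poly \<Rightarrow> real fps"
    by unfold_locales (simp_all add: fps_of_poly_add fps_of_poly_mult)
  have "mat n n (\<lambda>(i, j). (if i = j then 1 else 0) - fps_const (A $$ (i, j)) * fps_X) =
      map_mat fps_of_poly Q"
    by (rule eq_matI)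
      (auto simp: Q_def fps_of_poly_pCons fps_const_neg[symmetric] simp del: fps_const_neg)
  then have "det (mat n n (\<lambda>(i, j). (if i = j then 1 else 0) - fps_const (A $$ (i, j)) * fps_X)) =
      fps_of_poly r"
    using \<open>det Q = r\<close> by simp
  also have "\<dots> = (\<Prod>x\<leftarrow>real_eigenvalues A. 1 - fps_const x * fps_X)"
    by (simp add: r_def fps_of_poly_prod_list o_def fps_of_poly_pCons fps_const_neg[symmetric]
        del: fps_const_neg)
  finally show ?thesis .
qed

section \<open>Determinants and walks\<close>

text \<open>
  A vertex of \<open>vs\<close> that is not met by \<open>E\<close> contributes an identity row and column. Hence the
  determinant of any subgraph can be written over the same vertex list, without reindexing.
\<close>

definition one_minus_X_adjacency :: "'a list \<Rightarrow> 'a rel \<Rightarrow> real fps mat" where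
  "one_minus_X_adjacency vs E = mat (length vs) (length vs)
     (\<lambda>(i, j). (if i = j then 1 else 0) - (if (vs ! i, vs ! j) \<in> E then fps_X else 0))"

definition rev_char_fps :: "'a list \<Rightarrow> 'a rel \<Rightarrow> real fps" where
  "rev_char_fps vs E = det (one_minus_X_adjacency vs E)"

definition del_vertex :: "'a \<Rightarrow> 'a rel \<Rightarrow> 'a rel" where
  "del_vertex u E = {(x, y) \<in> E. x \<noteq> u \<and> y \<noteq> u}"

lemma one_minus_X_adjacency_carrier [simp]:
  "one_minus_X_adjacency vs E \<in> carrier_mat (length vs) (length vs)"
  "dim_row (one_minus_X_adjacency vs E) = length vs"
  "dim_col (one_minus_X_adjacency vs E) = length vs"
  by (simp_all add: one_minus_X_adjacency_def)

text \<open>Modulo X the matrix is the identity. The constant term 1 makes \<open>inverse\<close> a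
  genuine reciprocal for all these determinants.\<close>

lemma rev_char_fps_nth_0 [simp]: "fps_nth (rev_char_fps vs E) 0 = 1"
proof -
  interpret fps_nth_0: comm_ring_hom "\<lambda>f :: real fps. fps_nth f 0"
    by unfold_locales simp_all
  have "map_mat (\<lambda>f. fps_nth f 0) (one_minus_X_adjacency vs E) = 1\<^sub>m (length vs)"
    by (rule eq_matI) (auto simp: one_minus_X_adjacency_def)
  then show ?thesis
    using fps_nth_0.hom_det[of "one_minus_X_adjacency vs E"] by (simp add: rev_char_fps_def)
qed

lemma rev_char_fps_mult_inverse [simp]: "rev_char_fps vs E * inverse (rev_char_fps vs E) = 1"
  by (simp add: inverse_mult_eq_1')

lemma rev_char_fps_empty [simp]: "rev_char_fps vs {} = 1"
proof -
  have "one_minus_X_adjacency vs {} = 1\<^sub>m (length vs)"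
    by (rule eq_matI) (auto simp: one_minus_X_adjacency_def)
  then show ?thesis
    by (simp add: rev_char_fps_def)
qed

text \<open>The supports are disjoint, so the product of the two adjacency matrices vanishes and the
  matrices I - X A themselves multiply to the one of the union.\<close>

lemma rev_char_fps_Un:
  assumes "A \<inter> B = {}" "E \<subseteq> A \<times> A" "F \<subseteq> B \<times> B"
  shows "rev_char_fps vs (E \<union> F) = rev_char_fps vs E * rev_char_fps vs F"
proof -
  let ?n = "length vs" and ?X = "\<lambda>E i j. if (vs ! i, vs ! j) \<in> E then fps_X else 0 :: real fps"
  have "one_minus_X_adjacency vs (E \<union> F) = one_minus_X_adjacency vs E * one_minus_X_adjacency vs F"
  proof (rule eq_matI)
    fix i j
    assume "i < dim_row (one_minus_X_adjacency vs E * one_minus_X_adjacency vs F)"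
      and "j < dim_col (one_minus_X_adjacency vs E * one_minus_X_adjacency vs F)"
    then have ij: "i < ?n" "j < ?n" by simp_all
    have "(one_minus_X_adjacency vs E * one_minus_X_adjacency vs F) $$ (i, j) =
        (\<Sum>k<?n. ((if i = k then 1 else 0) - ?X E i k) * ((if k = j then 1 else 0) - ?X F k j))"
      using ij by (simp add: one_minus_X_adjacency_def scalar_prod_def atLeast0LessThan)
    also have "\<dots> = (\<Sum>k<?n. (if i = k then (if k = j then 1 else 0) - ?X F k j else 0) -
        (if k = j then ?X E i k else 0))"
      using assms by (intro sum.cong refl) (auto simp: algebra_simps)
    also have "\<dots> = (if i = j then 1 else 0) - ?X F i j - ?X E i j"
      using ij by (simp add: sum_subtractf)
    also have "\<dots> = one_minus_X_adjacency vs (E \<union> F) $$ (i, j)"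
      using ij assms by (auto simp: one_minus_X_adjacency_def)
    finally show "one_minus_X_adjacency vs (E \<union> F) $$ (i, j) =
        (one_minus_X_adjacency vs E * one_minus_X_adjacency vs F) $$ (i, j)" ..
  qed simp_all
  then show ?thesis
    by (simp add: rev_char_fps_def det_mult[of _ "length vs"])
qed

text \<open>The equation for \<open>w\<close> is the linear system with matrix I - X A and the unit
  vector at \<open>u\<close> on the right. It is solved by Cramer's rule for an arbitrary solution
  \<open>w\<close>, since \<open>join_edge_fps\<close> supplies one of its own.\<close>

lemma rev_char_fps_cramer:
  assumes vs: "distinct vs" "u \<in> set vs"
    and w: "\<And>x. x \<in> set vs \<Longrightarrow>
      w x = (if x = u then 1 else 0) + fps_X * (\<Sum>z | z \<in> set vs \<and> (x, z) \<in> E. w z)"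
  shows "rev_char_fps vs E * w u = rev_char_fps vs (del_vertex u E)"
proof -
  let ?n = "length vs" and ?M = "one_minus_X_adjacency vs E"
    and ?M' = "one_minus_X_adjacency vs (del_vertex u E)"
  obtain k where k: "k < ?n" "vs ! k = u"
    using vs(2) by (auto simp: in_set_conv_nth)
  have eq_u: "vs ! i = u \<longleftrightarrow> i = k" if "i < ?n" for i
    using vs(1) k that nth_eq_iff_index_eq by blast
  define y where "y = vec ?n (\<lambda>i. w (vs ! i))"
  define R where "R = replace_col ?M (unit_vec ?n k) k"
  have "?M *\<^sub>v y = unit_vec ?n k"
  proof (rule eq_vecI)
    fix i assume "i < dim_vec (unit_vec ?n k)"
    then have i: "i < ?n" by simp
    have "(?M *\<^sub>v y) $ i = (\<Sum>j<?n. (if i = j then w (vs ! j) else 0) -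
        fps_X * (if (vs ! i, vs ! j) \<in> E then w (vs ! j) else 0))"
      using i by (auto simp: scalar_prod_def y_def one_minus_X_adjacency_def atLeast0LessThan
          left_diff_distrib intro!: sum.cong)
    also have "\<dots> = w (vs ! i) - fps_X * (\<Sum>j<?n. if (vs ! i, vs ! j) \<in> E then w (vs ! j) else 0)"
      using i by (simp add: sum_subtractf sum_distrib_left)
    also have "(\<Sum>j<?n. if (vs ! i, vs ! j) \<in> E then w (vs ! j) else 0) =
        (\<Sum>z\<in>set vs. if (vs ! i, z) \<in> E then w z else 0)"
      by (rule sum.reindex_bij_betw[of "\<lambda>j. vs ! j" "{..<?n}" "set vs"
            "\<lambda>z. if (vs ! i, z) \<in> E then w z else 0"]) (simp add: bij_betw_nth vs(1))
    also have "\<dots> = (\<Sum>z | z \<in> set vs \<and> (vs ! i, z) \<in> E. w z)"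
      by (simp add: sum.inter_filter)
    also have "w (vs ! i) - fps_X * \<dots> = unit_vec ?n k $ i"
      using i k(1) w[of "vs ! i"] by (simp add: eq_u)
    finally show "(?M *\<^sub>v y) $ i = unit_vec ?n k $ i" .
  qed simp
  then have "det R = rev_char_fps vs E * w u"
    using cramer_lemma_mat[of ?M ?n y k] k
    by (simp add: R_def y_def rev_char_fps_def mult.commute)
  \<comment> \<open>Both \<open>R\<close> and \<open>?M'\<close> have a unit vector as column
    \<open>k\<close> and agree off row and column \<open>k\<close>. Expanding along that column
    gives the same cofactor for both.\<close>
  moreover have det_cofactor: "det C = cofactor C k k"
    if C: "C \<in> carrier_mat ?n ?n" "\<And>i. i < ?n \<Longrightarrow> C $$ (i, k) = (if i = k then 1 else 0)" 
    for C :: "real fps mat"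
  proof -
    have "det C = (\<Sum>i<?n. (if i = k then cofactor C i k else 0))"
      unfolding laplace_expansion_column[OF C(1) k(1)] by (intro sum.cong refl) (simp add: C(2))
    then show ?thesis
      using k(1) by simp
  qed
  moreover have "det R = cofactor R k k"
    using k(1) by (intro det_cofactor) (auto simp: R_def replace_col_def)
  moreover have "det ?M' = cofactor ?M' k k"
    using k by (intro det_cofactor) (auto simp: one_minus_X_adjacency_def del_vertex_def)
  moreover have "mat_delete R k k = mat_delete ?M' k k"
  proof (rule eq_matI)
    fix i j assume "i < dim_row (mat_delete ?M' k k)" "j < dim_col (mat_delete ?M' k k)"
    then have ij: "i < ?n - 1" "j < ?n - 1" by simp_all
    let ?i = "if i < k then i else Suc i" and ?j = "if j < k then j else Suc j"
    have "?i < ?n" "?j < ?n" "?i \<noteq> k" "?j \<noteq> k"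
      using ij by auto
    then have "R $$ (?i, ?j) = ?M' $$ (?i, ?j)"
      by (simp add: R_def replace_col_def one_minus_X_adjacency_def del_vertex_def eq_u del: if_split)
    then show "mat_delete R k k $$ (i, j) = mat_delete ?M' k k $$ (i, j)"
      using ij by (simp add: mat_delete_def R_def replace_col_def)
  qed (simp_all add: R_def replace_col_def)
  then have "cofactor R k k = cofactor ?M' k k"
    by (simp add: cofactor_def)
  ultimately show ?thesis
    by (simp add: rev_char_fps_def)
qed

section \<open>Walk counts and their generating functions\<close>

primrec walks :: "'a set \<Rightarrow> 'a rel \<Rightarrow> nat \<Rightarrow> 'a \<Rightarrow> 'a \<Rightarrow> real" where
  "walks V E 0 x y = (if x = y then 1 else 0)"
| "walks V E (Suc k) x y = (\<Sum>z | z \<in> V \<and> (x, z) \<in> E. walks V E k z y)"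

text \<open>For distinct \<open>vs\<close> with \<open>V = set vs\<close>, these are the entries of
  the inverse of \<open>one_minus_X_adjacency vs E\<close>.\<close>

definition walk_fps :: "'a set \<Rightarrow> 'a rel \<Rightarrow> 'a \<Rightarrow> 'a \<Rightarrow> real fps" where
  "walk_fps V E x y = Abs_fps (\<lambda>k. walks V E k x y)"

lemma walks_nonneg: "0 \<le> walks V E k x y"
  by (induction k arbitrary: x) (auto intro: sum_nonneg)

lemma walks_mono:
  assumes "finite V" "E \<subseteq> E'"
  shows "walks V E k x y \<le> walks V E' k x y"
proof (induction k arbitrary: x)
  case (Suc k)
  have "walks V E (Suc k) x y \<le> (\<Sum>z | z \<in> V \<and> (x, z) \<in> E. walks V E' k z y)"
    by (simp add: Suc.IH sum_mono)
  also have "\<dots> \<le> walks V E' (Suc k) x y"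
    using assms by (auto intro!: sum_mono2 walks_nonneg)
  finally show ?case .
qed simp

lemma walk_fps_nonneg: "0 \<preceq> walk_fps V E x y"
  by (simp add: fps_le_def walk_fps_def walks_nonneg)

lemma walk_fps_mono: "finite V \<Longrightarrow> E \<subseteq> E' \<Longrightarrow> walk_fps V E x y \<preceq> walk_fps V E' x y"
  by (simp add: fps_le_def walk_fps_def walks_mono)

text \<open>Splits a walk at its first step. This is the equation that
  \<open>rev_char_fps_cramer\<close> asks of \<open>w\<close>.\<close>

lemma walk_fps_rec:
  "walk_fps V E x y = (if x = y then 1 else 0) + fps_X * (\<Sum>z | z \<in> V \<and> (x, z) \<in> E. walk_fps V E z y)"
proof (rule fps_ext)
  fix k
  show "fps_nth (walk_fps V E x y) k = fps_nth ((if x = y then 1 else 0) +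
      fps_X * (\<Sum>z | z \<in> V \<and> (x, z) \<in> E. walk_fps V E z y)) k"
    by (cases k) (simp_all add: walk_fps_def fps_sum_nth)
qed

lemma rev_char_fps_mult_walk_fps:
  assumes "distinct vs" "u \<in> set vs"
  shows "rev_char_fps vs E * walk_fps (set vs) E u u = rev_char_fps vs (del_vertex u E)"
  using assms by (rule rev_char_fps_cramer) (rule walk_fps_rec)

text \<open>Building up the vertex set one vertex at a time factors the reciprocal determinant into
  closed-walk series, each at the newest vertex of the graph induced so far. Every factor is
  nonnegative and grows with the edge set.\<close>

lemma inverse_rev_char_fps_mono_nonneg:
  assumes vs: "distinct vs" and E: "E \<subseteq> E'"
  shows "inverse (rev_char_fps vs E) \<preceq> inverse (rev_char_fps vs E')"
    and "0 \<preceq> inverse (rev_char_fps vs E)"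
proof -
  have step: "inverse (rev_char_fps vs (Restr E (insert u S))) =
      walk_fps (set vs) (Restr E (insert u S)) u u * inverse (rev_char_fps vs (Restr E S))"
    if "u \<in> set vs" "u \<notin> S" for E u S
  proof (rule fps_inverse_unique)
    have "del_vertex u (Restr E (insert u S)) = Restr E S"
      using that by (auto simp: del_vertex_def)
    then show "rev_char_fps vs (Restr E (insert u S)) *
        (walk_fps (set vs) (Restr E (insert u S)) u u * inverse (rev_char_fps vs (Restr E S))) = 1"
      using rev_char_fps_mult_walk_fps[OF vs that(1), of "Restr E (insert u S)"]
      by (simp add: mult.assoc[symmetric])
  qed
  have "S \<subseteq> set vs \<Longrightarrow> 0 \<preceq> inverse (rev_char_fps vs (Restr E S)) \<and>
      inverse (rev_char_fps vs (Restr E S)) \<preceq> inverse (rev_char_fps vs (Restr E' S))"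
    if "finite S" for S
    using that
  proof induction
    case (insert u S)
    then have u: "u \<in> set vs" by simp
    have "walk_fps (set vs) (Restr E (insert u S)) u u \<preceq> walk_fps (set vs) (Restr E' (insert u S)) u u"
      using E by (intro walk_fps_mono) auto
    with insert show ?case
      unfolding step[OF u insert.hyps(2)]
      by (auto intro!: fps_mult_mono fps_nonneg_mult walk_fps_nonneg)
  qed simp
  from this[of "set vs"]
  have "0 \<preceq> inverse (rev_char_fps vs (Restr E (set vs))) \<and>
      inverse (rev_char_fps vs (Restr E (set vs))) \<preceq> inverse (rev_char_fps vs (Restr E' (set vs)))"
    by simp
  moreover have "rev_char_fps vs (Restr E (set vs)) = rev_char_fps vs E" for E
    unfolding rev_char_fps_def
    by (intro arg_cong[where f = det] eq_matI) (auto simp: one_minus_X_adjacency_def)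
  ultimately show "inverse (rev_char_fps vs E) \<preceq> inverse (rev_char_fps vs E')"
    "0 \<preceq> inverse (rev_char_fps vs E)"
    by simp_all
qed

text \<open>A closed walk at \<open>u\<close> alternates closed walks in \<open>E\<close> with
  excursions to \<open>c\<close> along the new edge, a closed walk in \<open>F\<close> there, and
  the way back; this is a geometric series. The proof verifies a candidate solution of the linear
  system instead of decomposing walks.\<close>

lemma join_edge_fps:
  assumes vs: "distinct vs" "A \<subseteq> set vs" "B \<subseteq> set vs"
    and AB: "A \<inter> B = {}" "E \<subseteq> A \<times> A" "F \<subseteq> B \<times> B" "u \<in> A" "c \<in> B"
  defines "J \<equiv> E \<union> F \<union> {(u, c), (c, u)}"
  defines "f \<equiv> walk_fps (set vs) E u u" and "g \<equiv> walk_fps (set vs) F c c"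
  shows "walk_fps (set vs) J u u = f * inverse (1 - fps_X\<^sup>2 * (f * g))"
    and "inverse (rev_char_fps vs J) =
      inverse (rev_char_fps vs E) * inverse (rev_char_fps vs F) * inverse (1 - fps_X\<^sup>2 * (f * g))"
proof -
  define V where "V = set vs"
  define D where "D = inverse (1 - fps_X\<^sup>2 * (f * g))"
  define a where "a x = walk_fps V E x u" for x
  define b where "b x = walk_fps V F x c" for x
  \<comment> \<open>The column of walk series towards \<open>u\<close>, assembled from those of the two sides.\<close>
  define w where "w x = D * (a x + fps_X * f * b x)" for x
  have ac: "a u = f" "b c = g"
    by (simp_all add: a_def b_def f_def g_def V_def)
  have D: "(1 - fps_X\<^sup>2 * (f * g)) * D = 1"
    unfolding D_def by (rule inverse_mult_eq_1') simp
  have a: "a x = (if x = u then 1 else 0) + fps_X * (\<Sum>z | z \<in> V \<and> (x, z) \<in> E. a z)" for x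
    unfolding a_def by (rule walk_fps_rec)
  have b: "b x = (if x = c then 1 else 0) + fps_X * (\<Sum>z | z \<in> V \<and> (x, z) \<in> F. b z)" for x
    unfolding b_def by (rule walk_fps_rec)
  have a0: "a x = 0" if "x \<in> B" for x
  proof -
    have "(\<Sum>z | z \<in> V \<and> (x, z) \<in> E. a z) = 0" "x \<noteq> u"
      using AB that by (auto intro: sum.neutral)
    then show ?thesis
      using a[of x] by simp
  qed
  have b0: "b x = 0" if "x \<in> A" for x
  proof -
    have "(\<Sum>z | z \<in> V \<and> (x, z) \<in> F. b z) = 0" "x \<noteq> c"
      using AB that by (auto intro: sum.neutral)
    then show ?thesis
      using b[of x] by simp
  qed
  have uc: "u \<noteq> c" "u \<in> V" "c \<in> V"
    using AB vs by (auto simp: V_def)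
  have w_rec: "w x = (if x = u then 1 else 0) + fps_X * (\<Sum>z | z \<in> V \<and> (x, z) \<in> J. w z)"
    if "x \<in> V" for x
  proof -
    have fin: "finite V"
      by (simp add: V_def)
    \<comment> \<open>\<open>S\<close> holds the neighbour of \<open>x\<close> through the new edge,
      if any. It lies on the side opposite to \<open>x\<close>, so it is not counted among the
      neighbours in \<open>E\<close> and \<open>F\<close>.\<close>
    define S where "S = (if x = u then {c} else if x = c then {u} else {})"
    have "{z \<in> V. (x, z) \<in> J} = {z \<in> V. (x, z) \<in> E} \<union> {z \<in> V. (x, z) \<in> F} \<union> S"
      using uc by (auto simp: J_def S_def)
    also have "sum w \<dots> = sum w ({z \<in> V. (x, z) \<in> E} \<union> {z \<in> V. (x, z) \<in> F}) + sum w S"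
      using AB fin by (intro sum.union_disjoint) (auto simp: S_def)
    also have "sum w ({z \<in> V. (x, z) \<in> E} \<union> {z \<in> V. (x, z) \<in> F}) =
        (\<Sum>z | z \<in> V \<and> (x, z) \<in> E. w z) + (\<Sum>z | z \<in> V \<and> (x, z) \<in> F. w z)"
      using AB fin by (intro sum.union_disjoint) auto
    also have "sum w S = (if x = u then w c else 0) + (if x = c then w u else 0)"
      using uc by (auto simp: S_def)
    also have "(\<Sum>z | z \<in> V \<and> (x, z) \<in> E. w z) = D * (\<Sum>z | z \<in> V \<and> (x, z) \<in> E. a z)"
      unfolding sum_distrib_left w_def using AB by (intro sum.cong refl) (auto simp: b0)
    also have "(\<Sum>z | z \<in> V \<and> (x, z) \<in> F. w z) = D * (fps_X * f * (\<Sum>z | z \<in> V \<and> (x, z) \<in> F. b z))"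
      unfolding sum_distrib_left w_def using AB by (intro sum.cong refl) (auto simp: a0)
    finally have "fps_X * (\<Sum>z | z \<in> V \<and> (x, z) \<in> J. w z) =
        D * (fps_X * (\<Sum>z | z \<in> V \<and> (x, z) \<in> E. a z)) +
        D * fps_X * f * (fps_X * (\<Sum>z | z \<in> V \<and> (x, z) \<in> F. b z)) +
        fps_X * ((if x = u then w c else 0) + (if x = c then w u else 0))"
      by (simp add: algebra_simps)
    also have "fps_X * (\<Sum>z | z \<in> V \<and> (x, z) \<in> E. a z) = a x - (if x = u then 1 else 0)"
      using a[of x] by simp
    also have "fps_X * (\<Sum>z | z \<in> V \<and> (x, z) \<in> F. b z) = b x - (if x = c then 1 else 0)"
      using b[of x] by simp
    also have "w c = D * (fps_X * f * g)"
      using AB by (simp add: w_def ac a0)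
    also have "w u = D * f"
      using AB by (simp add: w_def ac b0)
    \<comment> \<open>What is left over at \<open>x = u\<close> is the product of \<open>D\<close>
      with the series that it inverts, which is 1.\<close>
    also have "D * (a x - (if x = u then 1 else 0)) + D * fps_X * f * (b x - (if x = c then 1 else 0)) +
        fps_X * ((if x = u then D * (fps_X * f * g) else 0) + (if x = c then D * f else 0)) =
        w x - (if x = u then (1 - fps_X\<^sup>2 * (f * g)) * D else 0)"
      using uc(1) by (auto simp: w_def algebra_simps power2_eq_square)
    finally show ?thesis
      using D by simp
  qed
  \<comment> \<open>\<open>w\<close> and the true walk series satisfy the same Cramer identity, so
    cancelling the determinant identifies them at \<open>u\<close>.\<close>
  have "rev_char_fps vs J * w u = rev_char_fps vs (del_vertex u J)"
    using vs(1) uc(2) w_rec by (intro rev_char_fps_cramer) (auto simp: V_def)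
  moreover have "rev_char_fps vs J * walk_fps (set vs) J u u = rev_char_fps vs (del_vertex u J)"
    using uc(2) by (intro rev_char_fps_mult_walk_fps[OF vs(1)]) (simp add: V_def)
  moreover have nz: "rev_char_fps vs J \<noteq> 0"
    using rev_char_fps_nth_0[of vs J] by (metis fps_zero_nth zero_neq_one)
  moreover have wu: "w u = f * D"
    using AB by (simp add: w_def ac b0)
  ultimately show "walk_fps (set vs) J u u = f * inverse (1 - fps_X\<^sup>2 * (f * g))"
    unfolding D_def by (metis mult_cancel_left)
  \<comment> \<open>Without \<open>u\<close> no edge links the two sides, so the determinant
    factors. The common factor \<open>f\<close> has constant term 1 and can be cancelled.\<close>
  have "del_vertex u J = del_vertex u E \<union> F"
    using AB by (auto simp: del_vertex_def J_def)
  then have "rev_char_fps vs (del_vertex u J) = rev_char_fps vs (del_vertex u E) * rev_char_fps vs F"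
    using AB by (simp, intro rev_char_fps_Un[of A B]) (auto simp: del_vertex_def)
  also have "rev_char_fps vs (del_vertex u E) = rev_char_fps vs E * f"
    unfolding f_def using uc by (subst rev_char_fps_mult_walk_fps[OF vs(1)]) (auto simp: V_def)
  finally have "f * (rev_char_fps vs J * D) = f * (rev_char_fps vs E * rev_char_fps vs F)"
    using \<open>rev_char_fps vs J * w u = _\<close> wu by (simp add: mult_ac)
  moreover have "fps_nth f 0 = 1"
    by (simp add: f_def walk_fps_def)
  then have "f \<noteq> 0" by auto
  ultimately have "rev_char_fps vs J * D = rev_char_fps vs E * rev_char_fps vs F"
    by simp
  then have "rev_char_fps vs J * (inverse (rev_char_fps vs E) * inverse (rev_char_fps vs F) * D) =
      (rev_char_fps vs E * inverse (rev_char_fps vs E)) * (rev_char_fps vs F * inverse (rev_char_fps vs F))"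
    by (simp add: mult_ac del: rev_char_fps_mult_inverse)
  then show "inverse (rev_char_fps vs J) =
      inverse (rev_char_fps vs E) * inverse (rev_char_fps vs F) * inverse (1 - fps_X\<^sup>2 * (f * g))"
    by (intro fps_inverse_unique) (simp add: D_def)
qed

section \<open>The series of paths and stars\<close>

text \<open>The determinant of I - X A for the path on \<open>n\<close> vertices, a rescaled
  Chebyshev polynomial of the second kind: X^n U_n(1 / (2 X)).\<close>

fun path_fps :: "nat \<Rightarrow> real fps" where
  "path_fps 0 = 1"
| "path_fps (Suc 0) = 1"
| "path_fps (Suc (Suc n)) = path_fps (Suc n) - fps_X\<^sup>2 * path_fps n"

text \<open>The closed walks at an end of the path on \<open>n + 1\<close> vertices.\<close>

definition path_end_fps :: "nat \<Rightarrow> real fps" where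
  "path_end_fps n = path_fps n * inverse (path_fps (Suc n))"

lemma path_fps_nth_0 [simp]: "fps_nth (path_fps n) 0 = 1"
  by (induction n rule: path_fps.induct) simp_all

lemma path_fps_mult_inverse [simp]: "path_fps n * inverse (path_fps n) = 1"
  by (simp add: inverse_mult_eq_1')

text \<open>\<open>path_fps\<close> counts matchings of a path with weight -X^2 per edge. Cutting at
  an edge separates the matchings that avoid it from those that use it and thereby occupy both its
  ends.\<close>

lemma path_fps_add:
  "path_fps (Suc i + Suc j) = path_fps (Suc i) * path_fps (Suc j) - fps_X\<^sup>2 * (path_fps i * path_fps j)"
proof (induction i rule: path_fps.induct)
  case (3 i)
  have "path_fps (Suc (Suc (Suc i)) + Suc j) =
      path_fps (Suc (Suc i) + Suc j) - fps_X\<^sup>2 * path_fps (Suc i + Suc j)"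
    by simp
  then show ?case
    unfolding 3 by (simp add: algebra_simps)
qed (simp_all add: algebra_simps)

text \<open>The determinant formula of \<open>join_edge_fps\<close> for two paths rooted at the ends
  of the cut edge, so that lower bounds for the two pieces of a tree combine to a path
  again.\<close>

lemma inverse_path_fps_add:
  "inverse (path_fps (Suc i + Suc j)) = inverse (path_fps (Suc i)) * inverse (path_fps (Suc j)) *
     inverse (1 - fps_X\<^sup>2 * (path_end_fps i * path_end_fps j))"
proof -
  have "path_fps (Suc i) * path_fps (Suc j) * (1 - fps_X\<^sup>2 * (path_end_fps i * path_end_fps j)) =
      path_fps (Suc i) * path_fps (Suc j) - fps_X\<^sup>2 * (path_fps i * path_fps j) *
      (path_fps (Suc i) * inverse (path_fps (Suc i))) * (path_fps (Suc j) * inverse (path_fps (Suc j)))"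
    unfolding path_end_fps_def by (simp add: algebra_simps del: path_fps_mult_inverse path_fps.simps)
  also have "\<dots> = path_fps (Suc i + Suc j)"
    by (simp only: path_fps_add path_fps_mult_inverse mult_1_right)
  finally show ?thesis
    by (simp flip: fps_inverse_mult)
qed

text \<open>Cuts off a single vertex, whose own closed-walk series is 1.\<close>

lemma path_end_fps_Suc: "path_end_fps (Suc n) = inverse (1 - fps_X\<^sup>2 * path_end_fps n)"
  using inverse_path_fps_add[of 0 n]
  by (simp add: path_end_fps_def mult.assoc[symmetric] del: path_fps.simps(3))

lemma path_end_fps_nonneg: "0 \<preceq> path_end_fps n"
proof (induction n)
  case 0
  then show ?case by (simp add: path_end_fps_def)
next
  case (Suc n)
  then show ?case
    unfolding path_end_fps_Suc by (intro fps_geometric_nonneg fps_nonneg_mult) simp_all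
qed

lemma inverse_path_fps_nonneg: "0 \<preceq> inverse (path_fps n)"
proof (induction n)
  case (Suc n)
  have "inverse (path_fps (Suc n)) = inverse (path_fps n) * path_end_fps n"
    by (simp add: path_end_fps_def mult.assoc[symmetric] mult.commute del: path_fps.simps(3))
  then show ?case
    using Suc by (simp add: fps_nonneg_mult path_end_fps_nonneg)
qed simp

text \<open>The right side counts closed walks at vertex \<open>i + 1\<close> of the path on
  \<open>i + j + 2\<close> vertices, since deleting that vertex leaves paths on \<open>i\<close> and
  \<open>j + 1\<close> vertices. At an end there are at most as many.\<close>

lemma path_end_fps_join:
  "path_end_fps (Suc (i + j)) \<preceq>
     path_end_fps i * inverse (1 - fps_X\<^sup>2 * (path_end_fps i * path_end_fps j))"
proof -
  define q where "q = inverse (1 - fps_X\<^sup>2 * (path_end_fps i * path_end_fps j))"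
  have q: "0 \<preceq> q"
    unfolding q_def by (intro fps_geometric_nonneg fps_nonneg_mult path_end_fps_nonneg) simp_all
  have inv: "inverse (path_fps (Suc i + Suc j)) = inverse (path_fps (Suc i)) * inverse (path_fps (Suc j)) * q"
    unfolding q_def by (rule inverse_path_fps_add)
  have "path_end_fps i * q = path_fps i * (path_fps (Suc j) * inverse (path_fps (Suc j))) * inverse (path_fps (Suc i)) * q"
    by (simp add: path_end_fps_def)
  also have "\<dots> = path_fps i * path_fps (Suc j) * inverse (path_fps (Suc i + Suc j))"
    unfolding inv by (simp add: mult_ac del: path_fps_mult_inverse)
  finally have "path_end_fps i * q - path_end_fps (Suc (i + j)) =
      (path_fps i * path_fps (Suc j) - path_fps (i + Suc j)) * inverse (path_fps (Suc i + Suc j))"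
    by (simp add: path_end_fps_def left_diff_distrib del: path_fps.simps)
  moreover have "0 \<preceq> \<dots>"
  \<comment> \<open>For \<open>i = 0\<close> the vertex is itself an end and the difference
    vanishes. Otherwise \<open>path_fps_add\<close> leaves a single product.\<close>
  proof (cases i)
    case (Suc k)
    have pk: "path_end_fps k = path_fps k * inverse (path_fps i)"
      by (simp add: path_end_fps_def Suc)
    \<comment> \<open>The factor \<open>path_fps i * inverse (path_fps i)\<close> is inserted so
      that the product regroups into nonnegative series of closed walks at path ends.\<close>
    have "(path_fps i * path_fps (Suc j) - path_fps (i + Suc j)) * inverse (path_fps (Suc i + Suc j)) =
        fps_X\<^sup>2 * (path_fps k * path_fps j) * inverse (path_fps (Suc i + Suc j)) * (path_fps i * inverse (path_fps i))"
      unfolding Suc path_fps_add by simp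
    also have "\<dots> = fps_X\<^sup>2 * (path_end_fps k * path_end_fps i * path_end_fps j * q)"
      unfolding inv pk path_end_fps_def[of i] path_end_fps_def[of j] by (simp only: mult_ac)
    finally show ?thesis
      using q by (simp add: fps_nonneg_mult path_end_fps_nonneg)
  qed simp
  ultimately show ?thesis
    unfolding q_def[symmetric] by (subst fps_le_iff_diff_nonneg) simp
qed

text \<open>
  For the star with \<open>n\<close> leaves, the inverse determinant and the closed walks at the centre have the
  same series.
\<close>

definition star_fps :: "nat \<Rightarrow> real fps" where
  "star_fps n = inverse (1 - of_nat n * fps_X\<^sup>2)"

lemma star_fps_mult [simp]: "(1 - of_nat n * fps_X\<^sup>2) * star_fps n = 1"
  unfolding star_fps_def by (rule inverse_mult_eq_1') simp

lemma star_fps_nonneg: "0 \<preceq> star_fps n"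
  unfolding star_fps_def by (intro fps_geometric_nonneg fps_nonneg_mult) simp_all

lemma star_fps_Suc: "star_fps (Suc n) = star_fps n * inverse (1 - fps_X\<^sup>2 * star_fps n)"
proof -
  have "(1 - of_nat n * fps_X\<^sup>2) * (1 - fps_X\<^sup>2 * star_fps n) =
      1 - of_nat n * fps_X\<^sup>2 - fps_X\<^sup>2 * ((1 - of_nat n * fps_X\<^sup>2) * star_fps n)"
    by (simp add: algebra_simps)
  also have "\<dots> = 1 - of_nat (Suc n) * fps_X\<^sup>2"
    unfolding star_fps_mult by (simp add: algebra_simps)
  finally show ?thesis
    by (simp add: star_fps_def flip: fps_inverse_mult)
qed

text \<open>The left sides belong to the double star, two stars joined by an edge between their
  centres. Its determinant \<open>a * b - y\<close> exceeds the determinant \<open>m\<close> of the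
  single star by \<open>of_nat (i * j) * (y * y)\<close>.\<close>

lemma star_fps_join:
  defines "q \<equiv> \<lambda>i j. inverse (1 - fps_X\<^sup>2 * (star_fps i * star_fps j))"
  shows "star_fps i * star_fps j * q i j \<preceq> star_fps (Suc (i + j))"
    and "star_fps i * q i j \<preceq> star_fps (Suc (i + j))"
proof -
  define y :: "real fps" where "y = fps_X\<^sup>2"
  define a where "a = 1 - of_nat i * y"
  define b where "b = 1 - of_nat j * y"
  define m where "m = 1 - of_nat (Suc (i + j)) * y"
  have ab: "a * star_fps i = 1" "b * star_fps j = 1"
    by (simp_all add: a_def b_def y_def)
  have m: "m * star_fps (Suc (i + j)) = 1"
    unfolding m_def y_def by (rule star_fps_mult)
  have y: "0 \<preceq> y" "fps_nth y 0 = 0"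
    by (simp_all add: y_def)
  have q: "(1 - y * (star_fps i * star_fps j)) * q i j = 1"
    unfolding q_def y_def by (rule inverse_mult_eq_1') simp
  have "a * b * (1 - y * (star_fps i * star_fps j)) = a * b - y * (a * star_fps i) * (b * star_fps j)"
    by (simp add: algebra_simps)
  then have eq: "a * b * (1 - y * (star_fps i * star_fps j)) = a * b - y"
    using ab by simp
  have "(a * b - y) * (star_fps i * star_fps j * q i j) =
      (a * star_fps i) * (b * star_fps j) * ((1 - y * (star_fps i * star_fps j)) * q i j)"
    unfolding eq[symmetric] by (simp only: mult_ac)
  also have "\<dots> = 1"
    unfolding ab q by simp
  finally have inv: "inverse (a * b - y) = star_fps i * star_fps j * q i j"
    by (rule fps_inverse_unique)
  have nonneg: "0 \<preceq> inverse (a * b - y)"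
    unfolding inv q_def by (intro fps_nonneg_mult fps_geometric_nonneg star_fps_nonneg) simp_all
  have m_inv: "inverse m = star_fps (Suc (i + j))"
    using m by (rule fps_inverse_unique)
  have diff: "a * b - y - m = of_nat (i * j) * (y * y)"
    by (simp add: a_def b_def m_def algebra_simps)
  show "star_fps i * star_fps j * q i j \<preceq> star_fps (Suc (i + j))"
    unfolding inv[symmetric] m_inv[symmetric]
  proof (rule fps_inverse_le_inverse)
    show "fps_nth (a * b - y) 0 = 1" "fps_nth m 0 = 1"
      by (simp_all add: a_def b_def m_def y)
    show "0 \<preceq> (a * b - y - m) * (inverse (a * b - y) * inverse m)"
      unfolding diff using nonneg m_inv y star_fps_nonneg
      by (intro fps_nonneg_mult) (simp_all del: of_nat_mult)
  qed
  \<comment> \<open>The second inequality compares \<open>b\<close> over \<open>a * b - y\<close>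
    with 1 over \<open>m\<close>; both are brought to the common denominator.\<close>
  have "star_fps i * q i j = b * inverse (a * b - y)"
    unfolding inv using ab(2) by (simp add: mult_ac)
  moreover have "star_fps (Suc (i + j)) = (a * b - y) * inverse (a * b - y) * inverse m"
    by (subst inverse_mult_eq_1') (simp_all add: a_def b_def m_inv y)
  moreover have "b * inverse (a * b - y) = b * (m * inverse m) * inverse (a * b - y)"
    using m m_inv by simp
  ultimately have "star_fps (Suc (i + j)) - star_fps i * q i j =
      (a * b - y) * inverse (a * b - y) * inverse m - b * (m * inverse m) * inverse (a * b - y)"
    by presburger
  also have "\<dots> = (a * b - y - b * m) * inverse m * inverse (a * b - y)"
    by (simp add: algebra_simps)
  \<comment> \<open>The factor \<open>m + of_nat i * y\<close> has a negative coefficient. It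
    becomes nonnegative only after division by \<open>m\<close>.\<close>
  also have "a * b - y - b * m = of_nat j * y * (m + of_nat i * y)"
    by (simp add: a_def b_def m_def algebra_simps)
  also have "\<dots> * inverse m = of_nat j * y * (m * inverse m + of_nat i * y * inverse m)"
    by (simp add: algebra_simps)
  also have "\<dots> = of_nat j * y * (1 + of_nat i * y * inverse m)"
    using m m_inv by simp
  finally show "star_fps i * q i j \<preceq> star_fps (Suc (i + j))"
    using nonneg m_inv y star_fps_nonneg
    by (subst fps_le_iff_diff_nonneg) (simp add: fps_nonneg_mult fps_nonneg_add)
qed

section \<open>Rooted trees\<close>

text \<open>Trees are generated by the operation that \<open>join_edge_fps\<close> analyses: the new
  edge links the two roots, and the root of the first part is kept.\<close>

inductive rooted_tree :: "'a set \<Rightarrow> 'a \<Rightarrow> 'a rel \<Rightarrow> bool" where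
  single: "rooted_tree {u} u {}"
| join: "rooted_tree A u E \<Longrightarrow> rooted_tree B c F \<Longrightarrow> A \<inter> B = {} \<Longrightarrow>
    rooted_tree (A \<union> B) u (E \<union> F \<union> {(u, c), (c, u)})"

lemma rooted_treeD:
  assumes "rooted_tree A u E"
  shows "finite A" "u \<in> A" "E \<subseteq> A \<times> A"
  using assms by induction auto

lemma rooted_tree_card: "rooted_tree A u E \<Longrightarrow> card A = Suc (card A - 1)"
  by (metis One_nat_def Suc_pred card_gt_0_iff empty_iff rooted_treeD(1,2))

lemma walk_fps_empty: "walk_fps V {} u u = 1"
  by (subst walk_fps_rec) simp

text \<open>Both bounds are proved together, because the series of a joined tree involves the closed
  walks at the roots of both parts.\<close>

lemma rooted_tree_lower_bound:
  assumes "distinct vs" "rooted_tree A u E" "A \<subseteq> set vs"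
  shows "inverse (path_fps (card A)) \<preceq> inverse (rev_char_fps vs E) \<and>
    path_end_fps (card A - 1) \<preceq> walk_fps (set vs) E u u"
  using assms(2,3)
proof induction
  case (single u)
  then show ?case
    by (simp add: walk_fps_empty path_end_fps_def)
next
  case (join A u E B c F)
  note A = rooted_treeD[OF join.hyps(1)] and B = rooted_treeD[OF join.hyps(2)]
  define i where "i = card A - 1"
  define j where "j = card B - 1"
  have card: "card A = Suc i" "card B = Suc j" "card (A \<union> B) = Suc i + Suc j"
    using rooted_tree_card[OF join.hyps(1)] rooted_tree_card[OF join.hyps(2)] A(1) B(1) join.hyps(3)
    by (simp_all add: i_def j_def card_Un_disjoint)
  define f where "f = walk_fps (set vs) E u u"
  define g where "g = walk_fps (set vs) F c c"
  have IH: "inverse (path_fps (Suc i)) \<preceq> inverse (rev_char_fps vs E)" "path_end_fps i \<preceq> f"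
    "inverse (path_fps (Suc j)) \<preceq> inverse (rev_char_fps vs F)" "path_end_fps j \<preceq> g"
    using join.IH join.prems by (simp_all add: card f_def g_def)
  let ?p = "inverse (1 - fps_X\<^sup>2 * (path_end_fps i * path_end_fps j))"
  let ?q = "inverse (1 - fps_X\<^sup>2 * (f * g))"
  have pq: "?p \<preceq> ?q" "0 \<preceq> ?p"
    using IH by (intro fps_geometric_mono fps_geometric_nonneg fps_mult_mono fps_nonneg_mult
        path_end_fps_nonneg; simp)+
  have T: "walk_fps (set vs) (E \<union> F \<union> {(u, c), (c, u)}) u u = f * ?q"
    "inverse (rev_char_fps vs (E \<union> F \<union> {(u, c), (c, u)})) =
      inverse (rev_char_fps vs E) * inverse (rev_char_fps vs F) * ?q"
    unfolding f_def g_def using assms(1) join.prems join.hyps(3) A B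
    by (intro join_edge_fps[of vs A B]; simp)+
  have "inverse (path_fps (Suc i + Suc j)) \<preceq> inverse (rev_char_fps vs (E \<union> F \<union> {(u, c), (c, u)}))"
    unfolding T inverse_path_fps_add using IH pq
    by (intro fps_mult_mono fps_nonneg_mult inverse_path_fps_nonneg)
  \<comment> \<open>Joining the two paths at their roots may leave the root in the interior. Moving
    it to an end can only lower the series.\<close>
  moreover have "path_end_fps (Suc (i + j)) \<preceq> path_end_fps i * ?p"
    by (rule path_end_fps_join)
  moreover have "\<dots> \<preceq> f * ?q"
    using IH pq by (intro fps_mult_mono path_end_fps_nonneg)
  ultimately show ?case
    unfolding card T using fps_le_trans by auto
qed

text \<open>Each part is replaced by a star rooted at its centre, and \<open>star_fps_join\<close>
  passes from the resulting double star to a single star.\<close>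

lemma rooted_tree_upper_bound:
  assumes "distinct vs" "rooted_tree A u E" "A \<subseteq> set vs"
  shows "inverse (rev_char_fps vs E) \<preceq> star_fps (card A - 1) \<and>
    walk_fps (set vs) E u u \<preceq> star_fps (card A - 1)"
  using assms(2,3)
proof induction
  case (single u)
  then show ?case
    by (simp add: walk_fps_empty star_fps_def)
next
  case (join A u E B c F)
  note A = rooted_treeD[OF join.hyps(1)] and B = rooted_treeD[OF join.hyps(2)]
  define i where "i = card A - 1"
  define j where "j = card B - 1"
  have card: "card A = Suc i" "card B = Suc j" "card (A \<union> B) = Suc (Suc (i + j))"
    using rooted_tree_card[OF join.hyps(1)] rooted_tree_card[OF join.hyps(2)] A(1) B(1) join.hyps(3)
    by (simp_all add: i_def j_def card_Un_disjoint)
  define f where "f = walk_fps (set vs) E u u"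
  define g where "g = walk_fps (set vs) F c c"
  have IH: "inverse (rev_char_fps vs E) \<preceq> star_fps i" "f \<preceq> star_fps i"
    "inverse (rev_char_fps vs F) \<preceq> star_fps j" "g \<preceq> star_fps j"
    using join.IH join.prems by (simp_all add: card f_def g_def)
  \<comment> \<open>\<open>fps_mult_mono\<close> asks for nonnegative smaller factors, which here
    are the series of the tree itself.\<close>
  have nonneg: "0 \<preceq> f" "0 \<preceq> g" "0 \<preceq> inverse (rev_char_fps vs E)" "0 \<preceq> inverse (rev_char_fps vs F)"
    using inverse_rev_char_fps_mono_nonneg(2)[OF assms(1) order_refl] 
    by (simp_all add: f_def g_def walk_fps_nonneg)
  let ?p = "inverse (1 - fps_X\<^sup>2 * (star_fps i * star_fps j))"
  let ?q = "inverse (1 - fps_X\<^sup>2 * (f * g))"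
  have pq: "?q \<preceq> ?p" "0 \<preceq> ?q"
    using IH nonneg by (intro fps_geometric_mono fps_geometric_nonneg fps_mult_mono fps_nonneg_mult; simp)+
  have T: "walk_fps (set vs) (E \<union> F \<union> {(u, c), (c, u)}) u u = f * ?q"
    "inverse (rev_char_fps vs (E \<union> F \<union> {(u, c), (c, u)})) =
      inverse (rev_char_fps vs E) * inverse (rev_char_fps vs F) * ?q"
    unfolding f_def g_def using assms(1) join.prems join.hyps(3) A B
    by (intro join_edge_fps[of vs A B]; simp)+
  have "inverse (rev_char_fps vs (E \<union> F \<union> {(u, c), (c, u)})) \<preceq> star_fps i * star_fps j * ?p"
    unfolding T using IH pq nonneg by (intro fps_mult_mono fps_nonneg_mult)
  moreover have "f * ?q \<preceq> star_fps i * ?p"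
    using IH pq nonneg by (intro fps_mult_mono)
  ultimately show ?case
    unfolding card T using star_fps_join[of i j] fps_le_trans by auto
qed

text \<open>The inductive rule attaches new parts only at the root. A leaf at any other vertex is
  passed down to the part that contains this vertex.\<close>

lemma rooted_tree_add_leaf:
  assumes "rooted_tree A u E" "x \<in> A" "y \<notin> A"
  shows "rooted_tree (insert y A) u (E \<union> {(x, y), (y, x)})"
  using assms
proof induction
  case (single u)
  then show ?case
    using join[OF rooted_tree.single[of u] rooted_tree.single[of y]] by (auto simp: insert_commute)
next
  case (join A u E B c F)
  show ?case
  proof (cases "x \<in> A")
    case True
    then have "rooted_tree (insert y A \<union> B) u (E \<union> {(x, y), (y, x)} \<union> F \<union> {(u, c), (c, u)})"
      using join by (intro rooted_tree.join) auto
    then show ?thesis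
      by (simp add: Un_ac insert_commute)
  next
    case False
    then have "rooted_tree (A \<union> insert y B) u (E \<union> (F \<union> {(x, y), (y, x)}) \<union> {(u, c), (c, u)})"
      using join by (intro rooted_tree.join) auto
    then show ?thesis
      by (simp add: Un_ac insert_commute)
  qed
qed

text \<open>A subtree containing \<open>u\<close> is grown by leaves: while it misses a vertex,
  reachability from \<open>u\<close> yields an edge that leaves it.\<close>

lemma ex_spanning_rooted_tree:
  assumes V: "finite V" "R \<subseteq> V \<times> V" "sym R" and u: "u \<in> V" "\<And>v. v \<in> V \<Longrightarrow> (u, v) \<in> R\<^sup>*"
  shows "\<exists>E \<subseteq> R. rooted_tree V u E"
proof -
  have "\<exists>E' \<subseteq> R. rooted_tree V u E'" if "rooted_tree A u E" "A \<subseteq> V" "E \<subseteq> R" for A E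
    using that
  proof (induction "card (V - A)" arbitrary: A E rule: less_induct)
    case less
    show ?case
    proof (cases "A = V")
      case False
      then obtain v where v: "v \<in> V" "v \<notin> A"
        using less.prems by auto
      have "u \<in> A"
        using rooted_treeD(2)[OF less.prems(1)] .
      then have "\<not> R `` A \<subseteq> A"
        using u(2)[OF v(1)] v(2) by (metis Image_closed_trancl ImageI)
      then obtain x y where xy: "(x, y) \<in> R" "x \<in> A" "y \<notin> A"
        by auto
      then have yV: "y \<in> V"
        using V by auto
      show ?thesis
      proof (rule less.hyps)
        show "card (V - insert y A) < card (V - A)"
          using V xy yV by (intro psubset_card_mono) auto
        show "rooted_tree (insert y A) u (E \<union> {(x, y), (y, x)})"
          using less.prems xy by (intro rooted_tree_add_leaf)
        show "insert y A \<subseteq> V" "E \<union> {(x, y), (y, x)} \<subseteq> R"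
          using less.prems xy yV V(3) by (auto dest: symD)
      qed
    qed (use less.prems in auto)
  qed
  from this[OF single] u(1) show ?thesis
    by simp
qed

section \<open>Comparison of graphs\<close>

lemma pcas_append_arc: "pcas x p u \<Longrightarrow> pcas x (p @ (u, c) # q) y = pcas c q y"
  by (induction p arbitrary: x) auto

lemma pawalk_verts_append_arc:
  "pcas x p u \<Longrightarrow> pawalk_verts x (p @ (u, c) # q) = pawalk_verts x p @ pawalk_verts c q"
  by (induction p arbitrary: x) auto

lemma set_pawalk_verts_subset: "x \<in> A \<Longrightarrow> set p \<subseteq> A \<times> A \<Longrightarrow> set (pawalk_verts x p) \<subseteq> A"
  by (induction p arbitrary: x) fastforce+

lemma rooted_tree_ex_path:
  assumes "rooted_tree A u E" "x \<in> A" "y \<in> A"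
  shows "\<exists>p. pcas x p y \<and> set p \<subseteq> E \<and> distinct (pawalk_verts x p)"
  using assms
proof (induction arbitrary: x y)
  case (single u)
  then show ?case
    by (intro exI[of _ "[]"]) simp
next
  case (join A u E B c F)
  note A = rooted_treeD[OF join.hyps(1)] and B = rooted_treeD[OF join.hyps(2)]
  \<comment> \<open>Two paths in disjoint vertex sets, linked by one arc, form a path. The sets
    \<open>S\<close> and \<open>T\<close> are kept general so that the new edge can be crossed in
    either direction.\<close>
  have cross: "\<exists>r. pcas x r y \<and> set r \<subseteq> E \<union> F \<union> {(a, b)} \<and> distinct (pawalk_verts x r)"
    if "pcas x p a" "set p \<subseteq> S \<times> S" "distinct (pawalk_verts x p)" "x \<in> S" "set p \<subseteq> E \<union> F"
      "pcas b q y" "set q \<subseteq> T \<times> T" "distinct (pawalk_verts b q)" "b \<in> T" "set q \<subseteq> E \<union> F" "S \<inter> T = {}"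
    for x y a b p q S T
    using that set_pawalk_verts_subset[of x S p] set_pawalk_verts_subset[of b T q]
    by (intro exI[of _ "p @ (a, b) # q"]) (auto simp: pcas_append_arc pawalk_verts_append_arc)
  consider "x \<in> A" "y \<in> A" | "x \<in> B" "y \<in> B" | "x \<in> A" "y \<in> B" | "x \<in> B" "y \<in> A"
    using join.prems by blast
  then show ?case
  proof cases
    case 1
    then show ?thesis
      using join.IH(1) by blast
  next
    case 2
    then show ?thesis
      using join.IH(2) by blast
  next
    case 3
    obtain p q where p: "pcas x p u" "set p \<subseteq> E" "distinct (pawalk_verts x p)"
      and q: "pcas c q y" "set q \<subseteq> F" "distinct (pawalk_verts c q)"
      using join.IH 3 A(2) B(2) by metis
    have "\<exists>r. pcas x r y \<and> set r \<subseteq> E \<union> F \<union> {(u, c)} \<and> distinct (pawalk_verts x r)"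
      using p q A B 3 join.hyps by (intro cross[of x p u A c q y B]) auto
    then show ?thesis by blast
  next
    case 4
    obtain p q where p: "pcas x p c" "set p \<subseteq> F" "distinct (pawalk_verts x p)"
      and q: "pcas u q y" "set q \<subseteq> E" "distinct (pawalk_verts u q)"
      using join.IH 4 A(2) B(2) by metis
    have "\<exists>r. pcas x r y \<and> set r \<subseteq> E \<union> F \<union> {(c, u)} \<and> distinct (pawalk_verts x r)"
      using p q A B 4 join.hyps by (intro cross[of x p c B u q y A]) auto
    then show ?thesis by blast
  qed
qed

lemma pair_graph_arcs:
  assumes "pair_graph G"
  shows "finite (pverts G)" "parcs G \<subseteq> pverts G \<times> pverts G" "sym (parcs G)"
    "(x, y) \<in> parcs G \<Longrightarrow> x \<noteq> y"
proof -
  interpret pair_graph G by fact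
  show "finite (pverts G)" by (rule pair_finite_verts)
  show "parcs G \<subseteq> pverts G \<times> pverts G" using wellformed' by auto
  show "sym (parcs G)" using pair_sym_arcs by (simp add: symmetric_def)
  show "x \<noteq> y" if "(x, y) \<in> parcs G" using pair_no_loops[OF that] by simp
qed

lemma connected_ex_spanning_rooted_tree:
  assumes G: "pair_graph G" "Digraph_Component.connected (with_proj G)"
  shows "\<exists>u E. E \<subseteq> parcs G \<and> rooted_tree (pverts G) u E"
proof -
  interpret pair_graph G by fact
  have sc: "strongly_connected (with_proj G)"
    using G(2) pair_sym_arcs by (rule symmetric_connected_imp_strongly_connected[rotated])
  then obtain u where u: "u \<in> pverts G"
    by (auto simp: strongly_connected_def)
  have "(u, v) \<in> (parcs G)\<^sup>*" if "v \<in> pverts G" for v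
  proof -
    have "u \<rightarrow>\<^sup>*\<^bsub>with_proj G\<^esub> v"
      using sc u that by (auto simp: strongly_connected_def)
    then have "(u, v) \<in> rtrancl_on (pverts G) (parcs G)"
      by (simp add: reachable_def)
    then show ?thesis
      by induction auto
  qed
  then show ?thesis
    using ex_spanning_rooted_tree[of "pverts G" "parcs G" u] pair_graph_arcs[OF G(1)] u by blast
qed

text \<open>A spanning rooted tree already contains all arcs: any further arc would close the tree
  path between its ends to a cycle.\<close>

lemma tree_graph_is_rooted_tree:
  assumes "tree_graph T"
  shows "\<exists>u. rooted_tree (pverts T) u (parcs T)"
proof -
  have T: "pair_graph T" "Digraph_Component.connected (with_proj T)"
    and acyclic: "\<And>p. pre_digraph.cycle (with_proj T) p \<Longrightarrow> \<not> length p \<ge> 3"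
    using assms by (auto simp: tree_graph_def)
  obtain u E where E: "E \<subseteq> parcs T" "rooted_tree (pverts T) u E"
    using connected_ex_spanning_rooted_tree[OF T] by blast
  have "parcs T \<subseteq> E"
  proof (rule ccontr)
    assume "\<not> parcs T \<subseteq> E"
    then obtain x y where xy: "(x, y) \<in> parcs T" "(x, y) \<notin> E"
      by auto
    have V: "x \<in> pverts T" "y \<in> pverts T" "x \<noteq> y" "(y, x) \<in> parcs T"
      using xy pair_graph_arcs[OF T(1)] by (auto dest: symD)
    obtain p where p: "pcas x p y" "set p \<subseteq> E" "distinct (pawalk_verts x p)"
      using rooted_tree_ex_path[OF E(2) V(1,2)] by blast
    define q where "q = p @ [(y, x)]"
    obtain e p' where e: "p = e # p'"
      using p(1) V(3) by (cases p) auto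
    \<comment> \<open>A path with one arc would be \<open>(x, y)\<close> itself, which is not in
      \<open>E\<close>. Hence the cycle has length at least 3 and is not just an edge traversed back
      and forth.\<close>
    have "p' \<noteq> []"
      using p(1,2) xy(2) by (cases e) (auto simp: e)
    then have "length q \<ge> 3"
      by (cases p') (auto simp: q_def e)
    moreover have "pawalk_verts x q = pawalk_verts x p @ [x]" "pcas x q x"
      using pawalk_verts_append_arc[OF p(1), of x "[]"] pcas_append_arc[OF p(1), of x "[]" x]
      by (simp_all add: q_def)
    then have "pre_digraph.cycle (with_proj T) q"
      using p V E(1) by (auto simp: pre_digraph.cycle_def pre_digraph.awalk_def cas_with_proj_eq
          awalk_verts_with_proj_eq e q_def intro!: exI[of _ x])
    ultimately show False
      using acyclic by blast
  qed
  with E show ?thesis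
    by auto
qed

text \<open>Links the norm to determinants: the product of the factors
  \<open>1 - fps_const x * fps_X\<close> over the eigenvalues is both the determinant and the
  reciprocal of the generating function of \<open>chs\<close>.\<close>

lemma chs_graph_eigenvalues:
  assumes "sym (parcs G)" "distinct vs" "set vs = pverts G"
  shows "chs d (graph_eigenvalues G) = fps_nth (inverse (rev_char_fps vs (parcs G))) d"
proof -
  let ?A = "adjacency_matrix vs G" and ?n = "length vs"
  have "rev_char_fps vs (parcs G) =
      det (mat ?n ?n (\<lambda>(i, j). (if i = j then 1 else 0) - fps_const (?A $$ (i, j)) * fps_X))"
    unfolding rev_char_fps_def
    by (intro arg_cong[where f = det] eq_matI)
      (auto simp: one_minus_X_adjacency_def adjacency_matrix_def)
  also have "\<dots> = (\<Prod>x\<leftarrow>real_eigenvalues ?A. 1 - fps_const x * fps_X)"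
    using assms(1) by (intro det_one_minus_X_symmetric) (auto simp: adjacency_matrix_def dest: symD)
  finally have "fps_nth (inverse (rev_char_fps vs (parcs G))) d = chs d (real_eigenvalues ?A)"
    by (simp add: chs_generating_function[symmetric])
  then show ?thesis
    by (simp add: graph_eigenvalues_eq[OF assms(2,3)])
qed

section \<open>The series of the path, star and complete graphs\<close>

lemma path_graph_fps:
  assumes "distinct vs" "{1..Suc k} \<subseteq> set vs"
  shows "inverse (rev_char_fps vs (parcs (path_graph (Suc k)))) = inverse (path_fps (Suc k)) \<and>
    walk_fps (set vs) (parcs (path_graph (Suc k))) (Suc k) (Suc k) = path_end_fps k"
  using assms(2)
proof (induction k)
  case 0
  have "parcs (path_graph (Suc 0)) = {}"
    by (auto simp: path_graph_def)
  then show ?case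
    by (simp add: walk_fps_empty path_end_fps_def)
next
  case (Suc k)
  let ?E = "parcs (path_graph (Suc k))"
  \<comment> \<open>The new vertex forms the first part, with no edges, so that the root moves on to
    the new end of the path.\<close>
  have eq: "parcs (path_graph (Suc (Suc k))) = {} \<union> ?E \<union> {(Suc (Suc k), Suc k), (Suc k, Suc (Suc k))}"
    by (auto simp: path_graph_def)
  have sub: "{Suc (Suc k)} \<subseteq> set vs" "{1..Suc k} \<subseteq> set vs"
    using Suc.prems by auto
  have IH: "inverse (rev_char_fps vs ?E) = inverse (path_fps (Suc k))"
    "walk_fps (set vs) ?E (Suc k) (Suc k) = path_end_fps k"
    using Suc.IH[OF sub(2)] by auto
  have E: "?E \<subseteq> {1..Suc k} \<times> {1..Suc k}"
    by (auto simp: path_graph_def)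
  have add: "inverse (path_fps (Suc (Suc k))) =
      inverse (path_fps (Suc k)) * inverse (1 - fps_X\<^sup>2 * path_end_fps k)"
    using inverse_path_fps_add[of 0 k] by (simp add: path_end_fps_def del: path_fps.simps(3))
  show ?case
    unfolding eq
    using join_edge_fps[of vs "{Suc (Suc k)}" "{1..Suc k}" "{}" ?E "Suc (Suc k)" "Suc k"] assms(1) sub E
    by (simp add: IH walk_fps_empty path_end_fps_Suc add del: path_fps.simps)
qed

lemma star_graph_fps:
  assumes "distinct vs" "{1..Suc k} \<subseteq> set vs"
  shows "inverse (rev_char_fps vs (parcs (star_graph (Suc k)))) = star_fps k \<and>
    walk_fps (set vs) (parcs (star_graph (Suc k))) 1 1 = star_fps k"
  using assms(2)
proof (induction k)
  case 0
  have "parcs (star_graph (Suc 0)) = {}"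
    by (auto simp: star_graph_def)
  then show ?case
    by (simp add: walk_fps_empty star_fps_def)
next
  case (Suc k)
  let ?E = "parcs (star_graph (Suc k))"
  \<comment> \<open>Here the new leaf forms the second part, so that the root stays at the
    centre.\<close>
  have eq: "parcs (star_graph (Suc (Suc k))) = ?E \<union> {} \<union> {(1, Suc (Suc k)), (Suc (Suc k), 1)}"
    by (auto simp: star_graph_def)
  have sub: "{Suc (Suc k)} \<subseteq> set vs" "{1..Suc k} \<subseteq> set vs"
    using Suc.prems by auto
  have IH: "inverse (rev_char_fps vs ?E) = star_fps k" "walk_fps (set vs) ?E 1 1 = star_fps k"
    using Suc.IH[OF sub(2)] by auto
  have E: "?E \<subseteq> {1..Suc k} \<times> {1..Suc k}"
    by (auto simp: star_graph_def)
  show ?case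
    unfolding eq
    using join_edge_fps[of vs "{1..Suc k}" "{Suc (Suc k)}" ?E "{}" 1 "Suc (Suc k)"] assms(1) sub E
    by (simp add: IH[simplified] walk_fps_empty star_fps_Suc)
qed

text \<open>Moves the complete graph onto the vertices of the graph to be compared. The two matrices
  are equal entry by entry.\<close>

lemma rev_char_fps_complete:
  assumes "distinct vs" "distinct ws" "length vs = length ws" "{1..n} = set ws"
  shows "rev_char_fps ws (parcs (complete_graph n)) = rev_char_fps vs {(x, y). x \<noteq> y}"
proof -
  have ws: "(ws ! i, ws ! j) \<in> parcs (complete_graph n) \<longleftrightarrow> i \<noteq> j" if "i < length ws" "j < length ws" for i j
  proof -
    have "ws ! i \<in> {1..n}" "ws ! j \<in> {1..n}"
      unfolding assms(4) using that by simp_all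
    then show ?thesis
      using that assms(2) by (simp add: complete_graph_def nth_eq_iff_index_eq)
  qed
  show ?thesis
    unfolding rev_char_fps_def using assms
    by (intro arg_cong[where f = det] eq_matI)
      (auto simp: one_minus_X_adjacency_def ws nth_eq_iff_index_eq)
qed

text \<open>The path is compared with a spanning tree of \<open>G\<close>, and the remaining edges
  of \<open>G\<close> only increase the coefficients. As \<open>root d\<close> is increasing for
  positive \<open>d\<close>, the norms compare in the same way.\<close>

lemma chs_norm_path_le_connected:
  assumes d: "d > 0"
    and G: "pair_graph G" "Digraph_Component.connected (with_proj G)" "card (pverts G) = n"
  shows "chs_norm d (path_graph n) \<le> chs_norm d G"
proof -
  obtain vs where vs: "distinct vs" "set vs = pverts G"
    using finite_distinct_list[OF pair_graph_arcs(1)[OF G(1)]] by blast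
  obtain u E where E: "E \<subseteq> parcs G" "rooted_tree (pverts G) u E"
    using connected_ex_spanning_rooted_tree[OF G(1,2)] by blast
  obtain k where k: "n = Suc k"
    using rooted_tree_card[OF E(2)] G(3) by simp
  obtain ws where ws: "distinct ws" "set ws = {1..n}"
    using finite_distinct_list[of "{1..n}"] by auto
  have "chs d (graph_eigenvalues (path_graph n)) = fps_nth (inverse (path_fps n)) d"
    using chs_graph_eigenvalues[of "path_graph n" ws d] path_graph_fps[of ws k] ws k
    by (auto simp: path_graph_def sym_def)
  moreover have "inverse (path_fps n) \<preceq> inverse (rev_char_fps vs E)"
    using rooted_tree_lower_bound[OF vs(1) E(2)] vs(2) G(3) by simp
  then have "inverse (path_fps n) \<preceq> inverse (rev_char_fps vs (parcs G))"
    using inverse_rev_char_fps_mono_nonneg(1)[OF vs(1) E(1)] fps_le_trans by blast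
  ultimately show ?thesis
    using d chs_graph_eigenvalues[OF pair_graph_arcs(3)[OF G(1)] vs, of d]
    by (simp add: chs_norm_def fps_le_def)
qed

lemma chs_norm_le_complete:
  assumes d: "d > 0" and G: "pair_graph G" "card (pverts G) = n"
  shows "chs_norm d G \<le> chs_norm d (complete_graph n)"
proof -
  obtain vs where vs: "distinct vs" "set vs = pverts G"
    using finite_distinct_list[OF pair_graph_arcs(1)[OF G(1)]] by blast
  obtain ws where ws: "distinct ws" "set ws = {1..n}"
    using finite_distinct_list[of "{1..n}"] by auto
  have "length vs = length ws"
    using vs ws G(2) by (metis card_atLeastAtMost diff_Suc_1 distinct_card)
  then have "rev_char_fps ws (parcs (complete_graph n)) = rev_char_fps vs {(x, y). x \<noteq> y}"
    using vs(1) ws by (intro rev_char_fps_complete) auto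
  then have "chs d (graph_eigenvalues (complete_graph n)) =
      fps_nth (inverse (rev_char_fps vs {(x, y). x \<noteq> y})) d"
    using chs_graph_eigenvalues[of "complete_graph n" ws d] ws
    by (auto simp: complete_graph_def sym_def)
  \<comment> \<open>Having no loops, \<open>G\<close> is a subgraph of the complete graph on its own
    vertices.\<close>
  moreover have "inverse (rev_char_fps vs (parcs G)) \<preceq> inverse (rev_char_fps vs {(x, y). x \<noteq> y})"
    using pair_graph_arcs(4)[OF G(1)] by (intro inverse_rev_char_fps_mono_nonneg(1)[OF vs(1)]) auto
  ultimately show ?thesis
    using d chs_graph_eigenvalues[OF pair_graph_arcs(3)[OF G(1)] vs, of d]
    by (simp add: chs_norm_def fps_le_def)
qed

lemma chs_norm_tree_le_star:
  assumes d: "d > 0" and T: "tree_graph T" "card (pverts T) = n"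
  shows "chs_norm d T \<le> chs_norm d (star_graph n)"
proof -
  have T': "pair_graph T"
    using T(1) by (simp add: tree_graph_def)
  obtain vs where vs: "distinct vs" "set vs = pverts T"
    using finite_distinct_list[OF pair_graph_arcs(1)[OF T']] by blast
  obtain u where u: "rooted_tree (pverts T) u (parcs T)"
    using tree_graph_is_rooted_tree[OF T(1)] by blast
  obtain k where k: "n = Suc k"
    using rooted_tree_card[OF u] T(2) by simp
  obtain ws where ws: "distinct ws" "set ws = {1..n}"
    using finite_distinct_list[of "{1..n}"] by auto
  have "chs d (graph_eigenvalues (star_graph n)) = fps_nth (star_fps k) d"
    using chs_graph_eigenvalues[of "star_graph n" ws d] star_graph_fps[of ws k] ws k
    by (auto simp: star_graph_def sym_def)
  moreover have "inverse (rev_char_fps vs (parcs T)) \<preceq> star_fps k"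
    using rooted_tree_upper_bound[OF vs(1) u] vs(2) T(2) k by simp
  ultimately show ?thesis
    using d chs_graph_eigenvalues[OF pair_graph_arcs(3)[OF T'] vs, of d]
    by (simp add: chs_norm_def fps_le_def)
qed

theorem theorem1p10:
  fixes d n :: nat
  assumes "even d" and "d \<ge> 2" and "n \<ge> 1"
  shows "(\<forall>G :: 'a pair_pre_digraph.
            pair_graph G \<and> Digraph_Component.connected (with_proj G) \<and> card (pverts G) = n \<longrightarrow>
              chs_norm d (path_graph n) \<le> chs_norm d G \<and>
              chs_norm d G \<le> chs_norm d (complete_graph n)) \<and>
         (\<forall>T :: 'b pair_pre_digraph.
            tree_graph T \<and> card (pverts T) = n \<longrightarrow>
              chs_norm d (path_graph n) \<le> chs_norm d T \<and>
              chs_norm d T \<le> chs_norm d (star_graph n))"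
proof (intro conjI allI impI; elim conjE)
  show "chs_norm d (path_graph n) \<le> chs_norm d G" "chs_norm d G \<le> chs_norm d (complete_graph n)"
    if "pair_graph G" "Digraph_Component.connected (with_proj G)" "card (pverts G) = n"
    for G :: "'a pair_pre_digraph"
    using assms that by (simp_all add: chs_norm_path_le_connected chs_norm_le_complete)
  show "chs_norm d (path_graph n) \<le> chs_norm d T" "chs_norm d T \<le> chs_norm d (star_graph n)"
    if "tree_graph T" "card (pverts T) = n" for T :: "'b pair_pre_digraph"
    using assms that chs_norm_tree_le_star[of d T n]
    by (simp_all add: tree_graph_def chs_norm_path_le_connected)
qed

end
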